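(* Let $1<q<r$ be real numbers such that $\lceil q\rceil=\lceil r\rceil$. The following statements are equivalent: (i) $(q,r]\cap\mathcal U=\varnothing$; (ii) $(q,r]\cap\overline{\mathcal U}=\varnothing$; (iii) each sequence $(c_i)\in\mathcal U_r'\setminus\mathcal U_q'$ is ultimately periodic; (iv) $\mathcal U_r'\setminus\mathcal U_q'$ is countable.
   Context: For a real number $q>1$, an expansion in base $q$ of a real number $x$ is a sequence $(c_i)=c_1c_2\ldots$ of integers with $0\le c_i<q$ for all $i\ge1$ and $x=\sum_{i=1}^\infty c_iq^{-i}$; such $x$ lie in $J_q=[0,(\lceil q\rceil-1)/(q-1)]$, where $\lceil q\rceil$ is the smallest integer $\ge q$. $\mathcal U_q$ denotes the set of $x\in J_q$ having exactly one expansion in base $q$, and $\mathcal U_q'$ denotes the set of all sequences that are the (unique) expansion in base $q$ of some $x\in\mathcal U_q$ (the univoque sequences in base $q$). $\mathcal U=\{q>1: 1 \text{ has a unique expansion in base } q\}$ is the set of univoque numbers, and $\overline{\mathcal U}$ is its closure in $\mathbb R$. A sequence $c_1c_2\ldots$ is ultimately periodic if $c_{n+1}c_{n+2}\ldots$ is periodic for some $n\ge0$. *)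

theory Defs
  imports "HOL-Analysis.Analysis"
begin

text \<open>A sequence \<open>c\<^sub>1 c\<^sub>2 c\<^sub>3 \<dots>\<close> is represented by a function \<open>c :: nat \<Rightarrow> int\<close> indexed from 0:
  \<open>c i\<close> stands for the digit \<open>c\<^sub>i\<^sub>+\<^sub>1\<close>, which has weight \<open>1 / q ^ (i + 1)\<close>.\<close>

definition is_expansion :: "real \<Rightarrow> real \<Rightarrow> (nat \<Rightarrow> int) \<Rightarrow> bool" where
  "is_expansion q x c \<longleftrightarrow>
     (\<forall>i. 0 \<le> c i \<and> real_of_int (c i) < q) \<and>
     (\<lambda>i. real_of_int (c i) / q ^ (i + 1)) sums x"

definition J :: "real \<Rightarrow> real set" where
  "J q = {0 .. (real_of_int \<lceil>q\<rceil> - 1) / (q - 1)}"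

definition univoque_set :: "real \<Rightarrow> real set" where
  "univoque_set q = {x \<in> J q. \<exists>!c. is_expansion q x c}"

definition univoque_seqs :: "real \<Rightarrow> (nat \<Rightarrow> int) set" where
  "univoque_seqs q = {c. \<exists>x\<in>univoque_set q. is_expansion q x c}"

definition univoque_numbers :: "real set" where
  "univoque_numbers = {q. 1 < q \<and> (\<exists>!c. is_expansion q 1 c)}"

definition periodic_seq :: "(nat \<Rightarrow> 'a) \<Rightarrow> bool" where
  "periodic_seq c \<longleftrightarrow> (\<exists>p>0. \<forall>i. c (i + p) = c i)"

definition ultimately_periodic :: "(nat \<Rightarrow> 'a) \<Rightarrow> bool" where
  "ultimately_periodic c \<longleftrightarrow> (\<exists>n. periodic_seq (\<lambda>i. c (n + i)))"

end

theory Submission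
  imports Defs
begin

text \<open>Let \<open>M = \<lceil>q\<rceil> - 1\<close>. A sequence \<open>c\<close> over \<open>{0..M}\<close> is univoque in base \<open>q\<close> iff every tail that follows a
  digit below \<open>M\<close>, and the reflection \<open>M - c\<^sub>n\<^sub>+\<^sub>1, M - c\<^sub>n\<^sub>+\<^sub>2, \<dots>\<close> of every tail that follows a positive
  digit, has value less than 1 in base \<open>q\<close>.

  If \<open>s \<in> (q, r]\<close> is univoque with expansion \<open>\<alpha>\<close> of 1, then \<open>\<alpha>\<close> is lexicographically at least all its
  tails and larger than their reflections. For arbitrarily large \<open>m\<close> the tail of \<open>\<alpha>\<close> after its first \<open>m\<close> digits
  may be replaced by the reflection of \<open>\<alpha>\<close>, and iterating this yields a perfect set of sequences
  which, preceded by the digit 0, are univoque in base \<open>r\<close> but not in base \<open>q\<close>, up to countably many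
  exceptions.

  Conversely, if \<open>c\<close> is univoque in base \<open>r\<close> but not in base \<open>q\<close> and not ultimately periodic, let \<open>\<beta>\<close> be
  the lexicographic supremum of the tails and reflected tails above, and let \<open>p\<close> be the base with
  \<open>\<beta>\<close> as expansion of 1. If \<open>\<beta>\<close> is not periodic then \<open>p\<close> is univoque; if in addition \<open>p = q\<close>, then \<open>q\<close> is
  a limit of univoque numbers from the right. If \<open>\<beta>\<close> is periodic, then \<open>p > q\<close> is a limit of univoque
  numbers from the left. Finally, limits of univoque numbers from the right are univoque.\<close>

section \<open>Lexicographic order\<close>

definition shift :: "nat \<Rightarrow> (nat \<Rightarrow> int) \<Rightarrow> nat \<Rightarrow> int" where
  "shift n c = (\<lambda>i. c (n + i))"

definition splice :: "nat \<Rightarrow> (nat \<Rightarrow> int) \<Rightarrow> (nat \<Rightarrow> int) \<Rightarrow> nat \<Rightarrow> int" where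
  "splice m a b = (\<lambda>i. if i < m then a i else b (i - m))"

definition agree :: "nat \<Rightarrow> (nat \<Rightarrow> int) \<Rightarrow> (nat \<Rightarrow> int) \<Rightarrow> bool" where
  "agree n c d \<longleftrightarrow> (\<forall>i<n. c i = d i)"

definition lex_at :: "nat \<Rightarrow> (nat \<Rightarrow> int) \<Rightarrow> (nat \<Rightarrow> int) \<Rightarrow> bool" where
  "lex_at n c d \<longleftrightarrow> agree n c d \<and> c n < d n"

definition lex_less :: "(nat \<Rightarrow> int) \<Rightarrow> (nat \<Rightarrow> int) \<Rightarrow> bool" where
  "lex_less c d \<longleftrightarrow> (\<exists>n. lex_at n c d)"

definition lex_le :: "(nat \<Rightarrow> int) \<Rightarrow> (nat \<Rightarrow> int) \<Rightarrow> bool" where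
  "lex_le c d \<longleftrightarrow> c = d \<or> lex_less c d"

lemma shift_0 [simp]: "shift 0 c = c"
  by (simp add: shift_def)

lemma shift_shift [simp]: "shift m (shift n c) = shift (n + m) c"
  by (simp add: shift_def add.assoc)

lemma shift_splice: "shift m (splice m a b) = b"
  by (simp add: shift_def splice_def)

lemma shift_splice_ge: "m \<le> j \<Longrightarrow> shift j (splice m a b) = shift (j - m) b"
  by (auto simp: shift_def splice_def fun_eq_iff)

lemma agree_splice: "agree m (splice m a b) a"
  by (simp add: agree_def splice_def)

lemma agree_sym: "agree n c d \<Longrightarrow> agree n d c"
  by (simp add: agree_def)

lemma agree_trans: "agree n c d \<Longrightarrow> agree n d e \<Longrightarrow> agree n c e"
  by (simp add: agree_def)

lemma agree_mono: "agree n c d \<Longrightarrow> m \<le> n \<Longrightarrow> agree m c d"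
  by (simp add: agree_def)

lemma agree_shift: "agree n c d \<Longrightarrow> j + m \<le> n \<Longrightarrow> agree m (shift j c) (shift j d)"
  by (simp add: agree_def shift_def)

lemma first_difference:
  assumes "c \<noteq> d"
  obtains n where "agree n c d" "c n \<noteq> d n"
proof -
  from assms obtain k where "c k \<noteq> d k" by (auto simp: fun_eq_iff)
  then have "c (LEAST k. c k \<noteq> d k) \<noteq> d (LEAST k. c k \<noteq> d k)"
    by (rule LeastI)
  then show ?thesis
    using that[of "LEAST k. c k \<noteq> d k"] not_less_Least unfolding agree_def by blast
qed

lemma lex_total: "c \<noteq> d \<Longrightarrow> lex_less c d \<or> lex_less d c"
  by (metis first_difference agree_sym lex_at_def lex_less_def linorder_neqE)

lemma lex_at_unique:
  assumes "lex_at n c d" "agree m c d" "c m \<noteq> d m"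
  shows "m = n"
  using assms unfolding lex_at_def agree_def by (metis less_irrefl linorder_neqE_nat)

lemma lex_less_irrefl [simp]: "\<not> lex_less c c"
  by (simp add: lex_less_def lex_at_def)

lemma lex_at_trans:
  "lex_at m c d \<Longrightarrow> lex_at n d e \<Longrightarrow> lex_at (min m n) c e"
  unfolding lex_at_def agree_def min_def
  by (cases m n rule: linorder_cases) (auto simp: not_le)

lemma lex_less_trans: "lex_less c d \<Longrightarrow> lex_less d e \<Longrightarrow> lex_less c e"
  unfolding lex_less_def using lex_at_trans by blast

lemma lex_le_less_trans: "lex_le c d \<Longrightarrow> lex_less d e \<Longrightarrow> lex_less c e"
  unfolding lex_le_def using lex_less_trans by blast

lemma lex_less_le_trans: "lex_less c d \<Longrightarrow> lex_le d e \<Longrightarrow> lex_less c e"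
  unfolding lex_le_def using lex_less_trans by blast

lemma lex_le_trans: "lex_le c d \<Longrightarrow> lex_le d e \<Longrightarrow> lex_le c e"
  unfolding lex_le_def using lex_less_trans by blast

lemma lex_le_refl [simp]: "lex_le c c"
  by (simp add: lex_le_def)

lemma lex_not_le: "\<not> lex_le c d \<longleftrightarrow> lex_less d c"
  unfolding lex_le_def using lex_total lex_less_trans lex_less_irrefl by metis

lemma lex_antisym: "lex_le c d \<Longrightarrow> lex_le d c \<Longrightarrow> c = d"
  using lex_not_le lex_le_def by metis

lemma lex_lessI: "lex_at n c d \<Longrightarrow> lex_less c d"
  by (auto simp: lex_less_def)

lemma lex_at_agree:
  assumes "lex_at n c d" "agree (Suc n) c c'" "agree (Suc n) d d'"
  shows "lex_at n c' d'"
  using assms by (auto simp: lex_at_def agree_def)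

lemma lex_less_shift_iff:
  assumes "agree n c d"
  shows "lex_less c d \<longleftrightarrow> lex_less (shift n c) (shift n d)"
proof
  assume "lex_less c d"
  then obtain k where k: "lex_at k c d" by (auto simp: lex_less_def)
  then have "n \<le> k" using assms by (force simp: lex_at_def agree_def not_le[symmetric])
  then have "lex_at (k - n) (shift n c) (shift n d)"
    using k by (auto simp: lex_at_def agree_def shift_def)
  then show "lex_less (shift n c) (shift n d)" by (rule lex_lessI)
next
  assume "lex_less (shift n c) (shift n d)"
  then obtain k where k: "lex_at k (shift n c) (shift n d)" by (auto simp: lex_less_def)
  have "c i = d i" if "i < n + k" for i
  proof (cases "i < n")
    case True then show ?thesis using assms by (simp add: agree_def)
  next
    case False
    then have "shift n c (i - n) = shift n d (i - n)"
      using k that unfolding lex_at_def agree_def by (metis add.commute less_diff_conv2 not_less)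
    then show ?thesis using False by (simp add: shift_def)
  qed
  then have "lex_at (n + k) c d"
    using k by (auto simp: lex_at_def agree_def shift_def)
  then show "lex_less c d" by (rule lex_lessI)
qed

section \<open>Suprema, cluster points and cardinality of sets of sequences\<close>

lemma lex_sup_exists:
  fixes D :: "(nat \<Rightarrow> int) set"
  assumes ne: "D \<noteq> {}" and bdd: "\<And>d i. d \<in> D \<Longrightarrow> 0 \<le> d i \<and> d i \<le> M"
  shows "\<exists>\<beta>. (\<forall>d\<in>D. lex_le d \<beta>) \<and> (\<forall>n. \<exists>d\<in>D. agree n d \<beta>)"
proof -
  \<comment> \<open>\<open>W n\<close> keeps the members of \<open>D\<close> whose first
    \<open>n\<close> digits were maximal in turn. They share these digits, which form a prefix of
    \<open>\<beta>\<close>; \<open>\<beta>\<close> itself may lie outside \<open>D\<close>.\<close>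
  define W where "W = rec_nat D (\<lambda>n W. {d \<in> W. d n = Max ((\<lambda>d. d n) ` W)})"
  define \<beta> where "\<beta> n = Max ((\<lambda>d. d n) ` W n)" for n
  have W0: "W 0 = D" and WS: "W (Suc n) = {d \<in> W n. d n = \<beta> n}" for n
    by (simp_all add: W_def \<beta>_def)
  have sub: "W n \<subseteq> D" for n by (induction n) (auto simp: W0 WS)
  have fin: "finite ((\<lambda>d. d n) ` W n)" for n
    by (rule finite_subset[of _ "{0..M}"]) (use sub[of n] bdd in \<open>auto simp: subset_iff\<close>)
  have mem: "W n \<noteq> {}" for n
  proof (induction n)
    case 0 then show ?case using ne by (simp add: W0)
  next
    case (Suc n)
    then have "\<beta> n \<in> (\<lambda>d. d n) ` W n" unfolding \<beta>_def by (intro Max_in fin) auto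
    then show ?case by (auto simp: WS)
  qed
  have W_iff: "d \<in> W n \<longleftrightarrow> d \<in> D \<and> agree n d \<beta>" for d n
    by (induction n) (auto simp: W0 WS agree_def less_Suc_eq)
  show ?thesis
  proof (intro exI[of _ \<beta>] conjI ballI allI)
    fix d assume d: "d \<in> D"
    show "lex_le d \<beta>"
    proof (cases "d = \<beta>")
      case False
      then obtain n where n: "agree n d \<beta>" "d n \<noteq> \<beta> n" by (rule first_difference)
      then have "d n \<in> (\<lambda>d. d n) ` W n" using d by (simp add: W_iff)
      then have "d n \<le> \<beta> n" unfolding \<beta>_def by (intro Max_ge fin)
      with n have "lex_at n d \<beta>" by (simp add: lex_at_def)
      then show ?thesis by (auto simp: lex_le_def lex_less_def)
    qed simp
  next
    fix n show "\<exists>d\<in>D. agree n d \<beta>" using mem[of n] W_iff by blast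
  qed
qed

text \<open>Sequential compactness by the pigeonhole principle: digits are fixed one at a time so
  that infinitely many indices remain.\<close>

lemma cluster_sequence_exists:
  fixes a :: "nat \<Rightarrow> nat \<Rightarrow> int"
  assumes bdd: "\<And>k i. 0 \<le> a k i \<and> a k i \<le> M"
  obtains \<gamma> where "\<And>n. infinite {k. agree n (a k) \<gamma>}"
proof -
  define v where "v S n = (SOME x. infinite {k \<in> S. a k n = x})" for S n
  define S where "S = rec_nat UNIV (\<lambda>n S. {k \<in> S. a k n = v S n})"
  define \<gamma> where "\<gamma> n = v (S n) n" for n
  have S0: "S 0 = UNIV" and SS: "S (Suc n) = {k \<in> S n. a k n = \<gamma> n}" for n
    by (simp_all add: S_def \<gamma>_def)
  have inf: "infinite (S n)" for n
  proof (induction n)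
    case (Suc n)
    have "finite ((\<lambda>k. a k n) ` S n)"
      by (rule finite_subset[of _ "{0..M}"]) (use bdd in auto)
    from pigeonhole_infinite[OF Suc this]
    have "\<exists>x. infinite {k \<in> S n. a k n = x}" by blast
    then show ?case unfolding SS \<gamma>_def v_def by (rule someI_ex)
  qed (simp add: S0)
  have "S n = {k. agree n (a k) \<gamma>}" for n
    by (induction n) (auto simp: S0 SS agree_def less_Suc_eq)
  with inf show ?thesis by (auto intro: that)
qed

text \<open>Diagonalisation against an enumeration: every cylinder met by \<open>P\<close> contains two points of \<open>P\<close>.\<close>

lemma uncountable_closure_of_perfect:
  fixes P :: "(nat \<Rightarrow> int) set"
  assumes p0: "p0 \<in> P"
    and perfect: "\<And>p n. p \<in> P \<Longrightarrow> \<exists>p'\<in>P. p' \<noteq> p \<and> agree n p' p"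
  shows "uncountable {d. agree N d p0 \<and> (\<forall>n. \<exists>p\<in>P. agree n d p)}" (is "uncountable ?C")
proof
  assume "countable ?C"
  have "p0 \<in> ?C" using p0 by (auto simp: agree_def)
  then have "?C \<noteq> {}" by blast
  define e where "e = from_nat_into ?C"
  have e: "range e = ?C"
    unfolding e_def by (rule range_from_nat_into) fact+
  \<comment> \<open>A state pairs a point of \<open>P\<close> with a length up to which its digits
    are final. Stage \<open>k\<close> selects a point that differs from \<open>e k\<close> within
    its final prefix.\<close>
  define Q where "Q k x \<longleftrightarrow> fst x \<in> P \<and> agree N (fst x) p0 \<and> N \<le> snd x \<and> k \<le> snd x"
    for k :: nat and x :: "(nat \<Rightarrow> int) \<times> nat"
  define R where "R k x y \<longleftrightarrow>
      agree (snd x) (fst y) (fst x) \<and> snd x \<le> snd y \<and> \<not> agree (snd y) (fst y) (e k)" for k x y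
  have step: "\<exists>y. Q (Suc k) y \<and> R k x y" if x: "Q k x" for k x
  proof -
    obtain p' where p': "p' \<in> P" "p' \<noteq> fst x" "agree (snd x) p' (fst x)"
      using perfect x Q_def by metis
    \<comment> \<open>The distinct points \<open>p'\<close> and \<open>fst x\<close> cannot both
      equal \<open>e k\<close>.\<close>
    then obtain p'' where p'': "p'' \<in> P" "p'' \<noteq> e k" "agree (snd x) p'' (fst x)"
      using x by (metis Q_def agree_def)
    obtain n where "p'' n \<noteq> e k n" using p''(2) by (auto simp: fun_eq_iff)
    then have "Q (Suc k) (p'', Suc (n + snd x + k)) \<and> R k x (p'', Suc (n + snd x + k))"
      using x p'' by (auto simp: Q_def R_def agree_def intro!: exI[of _ n])
    then show ?thesis by blast
  qed
  have "\<exists>f. \<forall>k. Q k (f k) \<and> R k (f k) (f (Suc k))"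
    by (rule dependent_nat_choice) (use step p0 in \<open>auto simp: Q_def agree_def\<close>)
  then obtain f where Qf: "\<And>k. Q k (f k)" and Rf: "\<And>k. R k (f k) (f (Suc k))" by blast
  define p L where "p k = fst (f k)" and "L k = snd (f k)" for k
  have LN: "N \<le> L k" "k \<le> L k" and pP: "p k \<in> P" "agree N (p k) p0" for k
    using Qf[of k] by (auto simp: Q_def p_def L_def)
  have agr: "agree (L k) (p (Suc k)) (p k)" "L k \<le> L (Suc k)"
    and diff: "\<not> agree (L (Suc k)) (p (Suc k)) (e k)" for k
    using Rf[of k] by (auto simp: R_def p_def L_def)
  have agr': "agree (L k) (p (k + j)) (p k)" for k j
  proof (induction j)
    case (Suc j)
    have "L k \<le> L (k + j)" using agr(2) by (simp add: lift_Suc_mono_le)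
    then show ?case using agree_trans[OF agree_mono[OF agr(1)[of "k + j"]] Suc] by simp
  qed (simp add: agree_def)
  \<comment> \<open>At stage \<open>Suc i\<close> the final prefix has length at least
    \<open>Suc i\<close>, so it contains position \<open>i\<close>.\<close>
  define d where "d i = p (Suc i) i" for i
  have d: "agree (L k) d (p k)" for k
    unfolding agree_def
  proof (intro allI impI)
    fix i assume i: "i < L k"
    show "d i = p k i"
    proof (cases "k \<le> Suc i")
      case True
      then show ?thesis using agr'[of k "Suc i - k"] i by (simp add: d_def agree_def)
    next
      case False
      then show ?thesis
        using agr'[of "Suc i" "k - Suc i"] LN(2)[of "Suc i"] by (simp add: d_def agree_def)
    qed
  qed
  have "agree N d p0"
    using agree_trans[OF agree_mono[OF d LN(1)] pP(2)] .
  moreover have "\<exists>p\<in>P. agree n d p" for n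
    using agree_mono[OF d LN(2)] pP(1) by blast
  ultimately have "d \<in> range e" unfolding e by blast
  then obtain k where "d = e k" by blast
  then show False using diff[of k] d[of "Suc k"] agree_sym by blast
qed

lemma countable_ultimately_periodic: "countable {c :: nat \<Rightarrow> int. ultimately_periodic c}"
proof -
  define h :: "int list \<times> int list \<Rightarrow> nat \<Rightarrow> int"
    where "h = (\<lambda>(xs, ys) i. if i < length xs then xs ! i else ys ! ((i - length xs) mod length ys))"
  have "c \<in> range h" if "ultimately_periodic c" for c
  proof -
    from that obtain n p where p: "p > 0" and per: "\<And>i. c (n + (i + p)) = c (n + i)"
      by (auto simp: ultimately_periodic_def periodic_seq_def)
    have add: "c (n + (i + j * p)) = c (n + i)" for i j
    proof (induction j)
      case (Suc j)
      then show ?case using per[of "i + j * p"] by (simp add: algebra_simps)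
    qed simp
    have "c (n + i) = c (n + i mod p)" for i
      using add[of "i mod p" "i div p"] by simp
    then have "c = h (map c [0..<n], map (\<lambda>i. c (n + i)) [0..<p])"
      using p by (force simp: h_def fun_eq_iff)
    then show ?thesis by blast
  qed
  then have "{c. ultimately_periodic c} \<subseteq> range h" by blast
  then show ?thesis by (rule countable_subset) simp
qed

section \<open>Values of digit sequences\<close>

definition val :: "real \<Rightarrow> (nat \<Rightarrow> int) \<Rightarrow> real" where
  "val q c = (\<Sum>i. real_of_int (c i) / q ^ (i + 1))"

text \<open>\<open>M\<close> is the largest digit. All bases in \<open>(M, M + 1]\<close> share it,
  so sequences for \<open>q\<close> and for \<open>r\<close> use the same digits.\<close>

locale alphabet =
  fixes M :: int
  assumes M_pos: "1 \<le> M"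
begin

definition digits :: "(nat \<Rightarrow> int) \<Rightarrow> bool" where
  "digits c \<longleftrightarrow> (\<forall>i. 0 \<le> c i \<and> c i \<le> M)"

definition reflect :: "(nat \<Rightarrow> int) \<Rightarrow> nat \<Rightarrow> int" where
  "reflect c = (\<lambda>i. M - c i)"

lemma digitsD: "digits c \<Longrightarrow> 0 \<le> c i" "digits c \<Longrightarrow> c i \<le> M"
  by (simp_all add: digits_def)

lemma digits_reflect [simp]: "digits (reflect c) \<longleftrightarrow> digits c"
  by (auto simp: digits_def reflect_def)

lemma digits_shift [simp]: "digits c \<Longrightarrow> digits (shift n c)"
  by (auto simp: digits_def shift_def)

lemma digits_splice: "digits a \<Longrightarrow> digits b \<Longrightarrow> digits (splice m a b)"
  by (auto simp: digits_def splice_def)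

lemma digits_M: "digits (\<lambda>_. M)"
  using M_pos by (simp add: digits_def)

lemma reflect_reflect [simp]: "reflect (reflect c) = c"
  by (simp add: reflect_def)

lemma reflect_eq_iff: "reflect c = d \<longleftrightarrow> c = reflect d"
  by auto

lemma shift_reflect: "shift n (reflect c) = reflect (shift n c)"
  by (simp add: shift_def reflect_def)

lemma agree_reflect [simp]: "agree n (reflect c) (reflect d) \<longleftrightarrow> agree n c d"
  by (simp add: agree_def reflect_def)

lemma lex_less_reflect [simp]: "lex_less (reflect c) (reflect d) \<longleftrightarrow> lex_less d c"
  by (simp add: lex_less_def lex_at_def) (auto simp: reflect_def intro: agree_sym)

lemma lex_le_reflect [simp]: "lex_le (reflect c) (reflect d) \<longleftrightarrow> lex_le d c"
  by (metis lex_le_def lex_less_reflect reflect_reflect)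

lemma lex_le_const: "digits c \<Longrightarrow> lex_le c (\<lambda>_. M)"
  by (meson digitsD(2) lex_not_le lex_at_def lex_less_def not_less)

lemma summable_val:
  assumes "1 < q" "digits c"
  shows "summable (\<lambda>i. real_of_int (c i) / q ^ (i + 1))"
proof (rule summable_comparison_test')
  show "summable (\<lambda>i. real_of_int M * (1 / q) ^ (i + 1))"
    using assms by (intro summable_mult summable_ignore_initial_segment summable_geometric) simp
  show "norm (real_of_int (c i) / q ^ (i + 1)) \<le> real_of_int M * (1 / q) ^ (i + 1)" if "0 \<le> i" for i
    using assms digitsD[OF assms(2), of i] by (simp add: power_divide divide_right_mono)
qed

lemma val_sums:
  assumes "1 < q" "digits c"
  shows "(\<lambda>i. real_of_int (c i) / q ^ (i + 1)) sums val q c"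
  using summable_val[OF assms] by (simp add: val_def summable_sums)

lemma val_split:
  assumes "1 < q" "digits c"
  shows "val q c = (\<Sum>i<n. real_of_int (c i) / q ^ (i + 1)) + val q (shift n c) / q ^ n"
proof -
  have "(\<lambda>i. real_of_int (c (i + n)) / q ^ (i + n + 1)) = (\<lambda>i. real_of_int (shift n c i) / q ^ (i + 1) / q ^ n)"
    by (simp add: shift_def power_add add_ac field_simps)
  then have "(\<Sum>i. real_of_int (c (i + n)) / q ^ (i + n + 1)) = val q (shift n c) / q ^ n"
    using suminf_divide[OF summable_val[OF assms(1) digits_shift[OF assms(2)]]] by (simp add: val_def)
  then show ?thesis
    using suminf_split_initial_segment[OF summable_val[OF assms], of n] by (simp add: val_def)
qed

lemma val_Cons:
  assumes "1 < q" "digits c"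
  shows "val q c = (c 0 + val q (shift 1 c)) / q"
  using val_split[OF assms, of 1] by (simp add: add_divide_distrib)

lemma val_nonneg:
  assumes "1 < q" "digits c"
  shows "0 \<le> val q c"
  unfolding val_def using assms digitsD[OF assms(2)] by (intro suminf_nonneg summable_val) auto

lemma val_const:
  assumes "1 < q"
  shows "val q (\<lambda>_. a) = a / (q - 1)"
proof -
  have "(\<lambda>i. (real_of_int a / q) * (1 / q) ^ i) sums ((real_of_int a / q) * (1 / (1 - 1 / q)))"
    using assms by (intro sums_mult geometric_sums) simp
  moreover have "(real_of_int a / q) * (1 / (1 - 1 / q)) = a / (q - 1)"
    using assms by (simp add: field_simps)
  moreover have "(\<lambda>i. real_of_int a / q ^ (i + 1)) = (\<lambda>i. (real_of_int a / q) * (1 / q) ^ i)"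
    by (simp add: power_divide)
  ultimately show ?thesis
    unfolding val_def by (metis sums_unique)
qed

lemma val_reflect:
  assumes "1 < q" "digits c"
  shows "val q (reflect c) = M / (q - 1) - val q c"
proof -
  have "val q c + val q (reflect c) = (\<Sum>i. real_of_int (c i) / q ^ (i + 1) + real_of_int (reflect c i) / q ^ (i + 1))"
    unfolding val_def
    by (rule suminf_add[OF summable_val[OF assms] summable_val]) (use assms in auto)
  also have "\<dots> = val q (\<lambda>_. M)"
    by (simp add: val_def reflect_def add_divide_distrib[symmetric])
  finally show ?thesis by (simp add: val_const assms)
qed

lemma val_le:
  assumes "1 < q" "digits c"
  shows "val q c \<le> M / (q - 1)"
  using val_reflect[OF assms] val_nonneg[of q "reflect c"] assms by simp

lemma prefix_le_val:
  assumes "1 < q" "digits c"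
  shows "(\<Sum>i<n. real_of_int (c i) / q ^ (i + 1)) \<le> val q c"
  using val_split[OF assms, of n] val_nonneg[of q "shift n c"] assms by simp

lemma val_pos:
  assumes "1 < q" "digits c" "c \<noteq> (\<lambda>_. 0)"
  shows "0 < val q c"
proof -
  obtain n where n: "c n \<noteq> 0" using assms(3) by auto
  have "0 < real_of_int (c n) / q ^ (n + 1)"
    using n digitsD(1)[OF assms(2), of n] assms(1) by simp
  also have "\<dots> \<le> (\<Sum>i<Suc n. real_of_int (c i) / q ^ (i + 1))"
    using assms digitsD(1)[OF assms(2)] by (simp add: sum_nonneg)
  also have "\<dots> \<le> val q c" by (rule prefix_le_val[OF assms(1,2)])
  finally show ?thesis .
qed

lemma val_antimono:
  assumes "1 < q" "q \<le> s" "digits c"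
  shows "val s c \<le> val q c"
  unfolding val_def
proof (rule suminf_le)
  fix i
  show "real_of_int (c i) / s ^ (i + 1) \<le> real_of_int (c i) / q ^ (i + 1)"
    using assms digitsD(1)[OF assms(3), of i]
    by (intro divide_left_mono power_mono mult_pos_pos zero_less_power) auto
qed (use assms summable_val in auto)

lemma val_antimono_strict:
  assumes "1 < q" "q < s" "digits c" "c \<noteq> (\<lambda>_. 0)"
  shows "val s c < val q c"
proof -
  obtain n where n: "c n \<noteq> 0" using assms(4) by auto
  then have pos: "0 < real_of_int (c n)" using digitsD(1)[OF assms(3), of n] by simp
  have "q ^ (n + 1) < s ^ (n + 1)" using assms by (intro power_strict_mono) auto
  then have *: "real_of_int (c n) / s ^ (n + 1) < real_of_int (c n) / q ^ (n + 1)"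
    using pos assms by (intro divide_strict_left_mono) auto
  have "(\<Sum>i<n. real_of_int (c i) / s ^ (i + 1)) \<le> (\<Sum>i<n. real_of_int (c i) / q ^ (i + 1))"
    using assms digitsD(1)[OF assms(3)]
    by (intro sum_mono divide_left_mono power_mono mult_pos_pos zero_less_power) auto
  moreover have "val s (shift (Suc n) c) / s ^ Suc n \<le> val q (shift (Suc n) c) / q ^ Suc n"
    using assms val_nonneg[of s "shift (Suc n) c"]
    by (intro frac_le val_antimono val_nonneg power_mono) auto
  ultimately show ?thesis
    using val_split[of s c "Suc n"] val_split[of q c "Suc n"] assms * by simp
qed

lemma val_diff:
  assumes "1 < q" "digits c" "digits d" "agree n c d"
  shows "val q d - val q c
    = (d n - c n + val q (shift (Suc n) d) - val q (shift (Suc n) c)) / q ^ Suc n"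
proof -
  have "(\<Sum>i<n. real_of_int (c i) / q ^ (i + 1)) = (\<Sum>i<n. real_of_int (d i) / q ^ (i + 1))"
    using assms(4) by (intro sum.cong) (auto simp: agree_def)
  then show ?thesis
    using val_split[of q c "Suc n"] val_split[of q d "Suc n"] assms
    by (simp add: add_divide_distrib diff_divide_distrib)
qed

text \<open>A gain of at least 1 at the first difference outweighs the remaining tail of
  \<open>c\<close>.\<close>

lemma val_less_if_lex_at:
  assumes "1 < q" "digits c" "digits d" "lex_at n c d" "val q (shift (Suc n) c) < 1"
  shows "val q c < val q d"
proof -
  have "1 \<le> d n - c n" using assms(4) by (simp add: lex_at_def)
  then have "1 \<le> real_of_int (d n - c n)" by linarith
  then have "0 < d n - c n + val q (shift (Suc n) d) - val q (shift (Suc n) c)"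
    using assms(5) val_nonneg[OF assms(1) digits_shift[OF assms(3)], of "Suc n"] by linarith
  then have "0 < val q d - val q c"
    using val_diff[of q c d n] assms by (simp add: lex_at_def)
  then show ?thesis by simp
qed

text \<open>Here the tail of \<open>c\<close> may have value exactly 1; the tail of
  \<open>d\<close>, kept as slack, still gives strictness when it is nonzero.\<close>

lemma val_le_if_lex_at:
  assumes "1 < q" "digits c" "digits d" "lex_at n c d" "val q (shift (Suc n) c) \<le> 1"
  shows "val q c \<le> val q d - val q (shift (Suc n) d) / q ^ Suc n"
proof -
  have "1 \<le> d n - c n" using assms(4) by (simp add: lex_at_def)
  then have "1 \<le> real_of_int (d n - c n)" by linarith
  then have "val q (shift (Suc n) d) \<le> d n - c n + val q (shift (Suc n) d) - val q (shift (Suc n) c)"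
    using assms(5) by linarith
  then have "val q (shift (Suc n) d) / q ^ Suc n \<le> val q d - val q c"
    unfolding val_diff[of q c d n, OF assms(1-3) assms(4)[unfolded lex_at_def, THEN conjunct1]]
    using assms(1) by (intro divide_right_mono) auto
  then show ?thesis by simp
qed

text \<open>If some tail of \<open>x\<close> had value above 1, each first difference with \<open>\<beta>\<close> would lead to a later tail
  whose excess over 1 is larger by a factor of at least \<open>q\<close>; but the values are bounded.\<close>

lemma val_le_one_if_tails_lex_le:
  assumes q: "1 < q" and x: "digits x" and \<beta>: "digits \<beta>" and \<beta>1: "val q \<beta> \<le> 1"
    and le: "\<And>n. lex_le (shift n x) \<beta>"
  shows "val q x \<le> 1"
proof (rule ccontr)
  assume "\<not> val q x \<le> 1"
  define t where "t = (SUP n. val q (shift n x) - 1)"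
  have bdd: "bdd_above (range (\<lambda>n. val q (shift n x) - 1))"
    by (rule bdd_aboveI[of _ "M / (q - 1) - 1"]) (use val_le[OF q] x in auto)
  have t: "val q (shift n x) - 1 \<le> t" for n
    unfolding t_def by (rule cSUP_upper[OF _ bdd]) simp
  have "0 < t" using t[of 0] \<open>\<not> val q x \<le> 1\<close> by simp
  have "val q (shift n x) - 1 \<le> t / q" for n
  proof (cases "shift n x = \<beta>")
    case True
    then show ?thesis using \<beta>1 \<open>0 < t\<close> q by (smt (verit) divide_nonneg_nonneg)
  next
    case False
    with le[of n] obtain k where k: "lex_at k (shift n x) \<beta>"
      by (auto simp: lex_le_def lex_less_def)
    have "1 \<le> \<beta> k - shift n x k" using k by (simp add: lex_at_def)
    then have "1 - val q (shift (n + Suc k) x)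
        \<le> \<beta> k - shift n x k + val q (shift (Suc k) \<beta>) - val q (shift (Suc k) (shift n x))"
      using val_nonneg[OF q digits_shift[OF \<beta>, of "Suc k"]]
      by (simp del: add_Suc_right)
    then have "(1 - val q (shift (n + Suc k) x)) / q ^ Suc k \<le> val q \<beta> - val q (shift n x)"
      unfolding val_diff[OF q digits_shift[OF x] \<beta> k[unfolded lex_at_def, THEN conjunct1]]
      using q by (intro divide_right_mono) auto
    moreover have "- t / q ^ Suc k \<le> (1 - val q (shift (n + Suc k) x)) / q ^ Suc k"
      using t[of "n + Suc k"] q by (intro divide_right_mono) auto
    ultimately have "val q (shift n x) - 1 \<le> t / q ^ Suc k"
      using \<beta>1 by simp
    also have "\<dots> \<le> t / q"
      using q \<open>0 < t\<close> self_le_power[of q "Suc k"] by (intro divide_left_mono) auto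
    finally show ?thesis .
  qed
  then have "t \<le> t / q" unfolding t_def by (intro cSUP_least) auto
  then show False using \<open>0 < t\<close> q by (simp add: field_simps)
qed

text \<open>All tails of \<open>x\<close> have value at most 1 by the preceding lemma, so the first
  difference from \<open>\<beta>\<close> decides. This is the bridge from lexicographic conditions
  to values.\<close>

lemma val_le_if_tails_lex_le:
  assumes q: "1 < q" and x: "digits x" and \<beta>: "digits \<beta>" and \<beta>1: "val q \<beta> \<le> 1"
    and le: "\<And>n. lex_le (shift n x) \<beta>"
  shows "val q x \<le> val q \<beta>"
    and "x \<noteq> \<beta> \<Longrightarrow> (\<And>n. shift n \<beta> \<noteq> (\<lambda>_. 0)) \<Longrightarrow> val q x < val q \<beta>"
proof -
  have *: "\<exists>n. val q x \<le> val q \<beta> - val q (shift (Suc n) \<beta>) / q ^ Suc n" if "x \<noteq> \<beta>"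
  proof -
    have "lex_less x \<beta>" using le[of 0] that by (simp add: lex_le_def)
    then obtain n where n: "lex_at n x \<beta>" by (auto simp: lex_less_def)
    have "val q (shift (Suc n) x) \<le> 1"
      using le by (intro val_le_one_if_tails_lex_le[OF q _ \<beta> \<beta>1]) (use x in auto)
    then show ?thesis using val_le_if_lex_at[OF q x \<beta> n] by blast
  qed
  have pos: "0 \<le> val q (shift (Suc n) \<beta>) / q ^ Suc n" for n
    using val_nonneg[OF q digits_shift[OF \<beta>]] q by simp
  show "val q x \<le> val q \<beta>"
    using * pos by (cases "x = \<beta>") (auto, smt (verit))
  show "val q x < val q \<beta>" if "x \<noteq> \<beta>" and nz: "\<And>n. shift n \<beta> \<noteq> (\<lambda>_. 0)"
  proof -
    from * that obtain n where n: "val q x \<le> val q \<beta> - val q (shift (Suc n) \<beta>) / q ^ Suc n" by blast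
    have "0 < val q (shift (Suc n) \<beta>) / q ^ Suc n"
      using val_pos[OF q digits_shift[OF \<beta>] nz] q by simp
    then show ?thesis using n by linarith
  qed
qed

text \<open>The bases \<open>Q k\<close> eventually exceed some \<open>q0 > 1\<close>, so one
  geometric series dominates all sums and Tannery's theorem applies. Constant digits give continuity
  in the base.\<close>

lemma val_tendsto:
  assumes q: "1 < q" and \<gamma>: "digits \<gamma>" and a: "\<And>k. digits (a k)" and F: "F \<noteq> bot"
    and Q: "(Q \<longlongrightarrow> q) F" and lim: "\<And>i. \<forall>\<^sub>F k in F. a k i = \<gamma> i"
  shows "((\<lambda>k. val (Q k) (a k)) \<longlongrightarrow> val q \<gamma>) F"
proof -
  obtain q0 where q0: "1 < q0" "q0 < q" using q dense by blast
  have ev: "\<forall>\<^sub>F k in F. q0 < Q k" using order_tendstoD(1)[OF Q q0(2)] .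
  have bound: "\<forall>\<^sub>F (i, k) in at_top \<times>\<^sub>F F.
      norm (real_of_int (a k i) / Q k ^ (i + 1)) \<le> real_of_int M * (1 / q0) ^ (i + 1)"
  proof -
    have "\<forall>\<^sub>F (i, k) in sequentially \<times>\<^sub>F F. q0 < Q k"
      using ev eventually_prod2[of sequentially "\<lambda>k. q0 < Q k" F] by simp
    then show ?thesis
    proof (rule eventually_mono, clarify)
      fix i k assume k: "q0 < Q k"
      have "real_of_int (a k i) / Q k ^ (i + 1) \<le> real_of_int M / q0 ^ (i + 1)"
        using k q0 digitsD[OF a, of k i] M_pos by (intro frac_le power_mono) auto
      then show "norm (real_of_int (a k i) / Q k ^ (i + 1)) \<le> real_of_int M * (1 / q0) ^ (i + 1)"
        using k q0 digitsD(1)[OF a, of k i] by (simp add: power_divide)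
    qed
  qed
  have conv: "((\<lambda>k. real_of_int (a k i) / Q k ^ (i + 1)) \<longlongrightarrow> real_of_int (\<gamma> i) / q ^ (i + 1)) F" for i
    using lim[of i] q Q
    by (intro tendsto_intros) (auto intro!: tendsto_eventually elim: eventually_mono)
  have sm: "summable (\<lambda>i. real_of_int M * (1 / q0) ^ (i + 1))"
    using q0 by (intro summable_mult summable_ignore_initial_segment summable_geometric) simp
  show ?thesis
    unfolding val_def using tannerys_theorem[OF conv bound sm F] by blast
qed

lemma continuous_on_val:
  assumes "1 < q" "digits c"
  shows "continuous_on {q..r} (\<lambda>x. val x c)"
  unfolding continuous_on_def
proof
  fix x assume x: "x \<in> {q..r}"
  show "((\<lambda>x. val x c) \<longlongrightarrow> val x c) (at x within {q..r})"
  proof (cases "at x within {q..r} = bot")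
    case False
    then show ?thesis using x assms by (intro val_tendsto) auto
  qed simp
qed

section \<open>The criterion for unique expansions\<close>

text \<open>The first clause forbids raising a digit by 1 and rewriting the digits after it, which
  for \<open>M < q \<le> M + 1\<close> is possible exactly when the tail has value at least 1. The
  second clause forbids lowering a digit, by reflection.\<close>

definition univoque :: "real \<Rightarrow> (nat \<Rightarrow> int) \<Rightarrow> bool" where
  "univoque q c \<longleftrightarrow> digits c \<and>
     (\<forall>n. (c n < M \<longrightarrow> val q (shift (Suc n) c) < 1) \<and>
          (0 < c n \<longrightarrow> val q (reflect (shift (Suc n) c)) < 1))"

lemma univoque_mono:
  assumes "1 < q" "q \<le> r" "univoque q c"
  shows "univoque r c"
  using assms val_antimono[of q r] unfolding univoque_def
  by (metis digits_reflect digits_shift le_less_trans)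

end

locale alphabet_base = alphabet +
  fixes q :: real
  assumes base: "real_of_int M < q" "q \<le> real_of_int M + 1"
begin

lemma base_gt_1: "1 < q"
  using base M_pos by linarith

lemma ceiling_base: "\<lceil>q\<rceil> = M + 1"
  using base by (simp add: ceiling_eq_iff)

lemma is_expansion_iff: "is_expansion q x c \<longleftrightarrow> digits c \<and> val q c = x"
proof -
  have "real_of_int a < q \<longleftrightarrow> a \<le> M" for a using base by linarith
  then have "is_expansion q x c \<longleftrightarrow> digits c \<and> (\<lambda>i. real_of_int (c i) / q ^ (i + 1)) sums x"
    by (simp add: is_expansion_def digits_def)
  then show ?thesis using val_sums[OF base_gt_1] sums_unique2 by blast
qed

lemma one_le_max: "1 \<le> M / (q - 1)"
  using base base_gt_1 by (simp add: field_simps)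

text \<open>The greedy algorithm, with the remainders \<open>y n\<close> confined to
  \<open>[0, M / (q - 1)]\<close>.\<close>

lemma expansion_exists:
  assumes "0 \<le> x" "x \<le> M / (q - 1)"
  obtains c where "digits c" "val q c = x"
proof -
  define dig where "dig y = min M \<lfloor>q * y\<rfloor>" for y
  define y where "y = rec_nat x (\<lambda>_ y. q * y - dig y)"
  have y0: "y 0 = x" and yS: "y (Suc n) = q * y n - dig (y n)" for n by (simp_all add: y_def)
  note q = base_gt_1
  \<comment> \<open>A digit capped at \<open>M\<close> leaves at most
    \<open>q * (M / (q - 1)) - M = M / (q - 1)\<close>; otherwise a fractional part remains, and
    \<open>1 \<le> M / (q - 1)\<close>.\<close>
  have dig: "0 \<le> dig z \<and> dig z \<le> M \<and> 0 \<le> q * z - dig z \<and> q * z - dig z \<le> M / (q - 1)"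
    if z: "0 \<le> z" "z \<le> M / (q - 1)" for z
  proof (cases "M \<le> \<lfloor>q * z\<rfloor>")
    case True
    have "q * z \<le> q * (M / (q - 1))" using z q by (intro mult_left_mono) auto
    also have "\<dots> = M + M / (q - 1)" using q by (simp add: field_simps)
    finally show ?thesis using True M_pos by (auto simp: dig_def le_floor_iff)
  next
    case False
    then have "dig z = \<lfloor>q * z\<rfloor>" by (simp add: dig_def)
    moreover have "0 \<le> \<lfloor>q * z\<rfloor>" using z q by simp
    moreover have "q * z - \<lfloor>q * z\<rfloor> \<le> 1" by linarith
    ultimately show ?thesis using False one_le_max by (auto intro: order_trans)
  qed
  have y: "0 \<le> y n \<and> y n \<le> M / (q - 1)" for n
    by (induction n) (use assms dig in \<open>auto simp: y0 yS\<close>)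
  define c where "c n = dig (y n)" for n
  have c: "digits c" using dig y by (auto simp: digits_def c_def)
  have part: "(\<Sum>i<n. real_of_int (c i) / q ^ (i + 1)) = x - y n / q ^ n" for n
  proof (induction n)
    case (Suc n)
    have "y n / q ^ n = c n / q ^ (n + 1) + y (Suc n) / q ^ Suc n"
      using q by (simp add: yS c_def field_simps)
    with Suc show ?case by simp
  qed (simp add: y0)
  have "(\<lambda>n. y n / q ^ n) \<longlonglongrightarrow> 0"
  proof (rule tendsto_sandwich[of "\<lambda>_. 0" _ _ "\<lambda>n. M / (q - 1) * (1 / q) ^ n"])
    show "\<forall>\<^sub>F n in sequentially. y n / q ^ n \<le> M / (q - 1) * (1 / q) ^ n"
    proof (intro always_eventually allI)
      fix n
      have "y n / q ^ n \<le> M / (q - 1) / q ^ n" using y q by (intro divide_right_mono) auto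
      then show "y n / q ^ n \<le> M / (q - 1) * (1 / q) ^ n" by (simp add: power_divide)
    qed
    have "(\<lambda>n. M / (q - 1) * (1 / q) ^ n) \<longlonglongrightarrow> M / (q - 1) * 0"
      using q by (intro tendsto_mult LIMSEQ_realpow_zero tendsto_const) auto
    then show "(\<lambda>n. M / (q - 1) * (1 / q) ^ n) \<longlonglongrightarrow> 0" by simp
  qed (use y q in auto)
  then have "(\<lambda>n. x - y n / q ^ n) \<longlonglongrightarrow> x - 0" by (intro tendsto_intros)
  then have "(\<lambda>i. real_of_int (c i) / q ^ (i + 1)) sums x"
    unfolding sums_def part by simp
  then have "val q c = x" using val_sums[OF q c] sums_unique2 by blast
  with c show ?thesis by (rule that)
qed

text \<open>Digit \<open>n\<close> is raised by 1, and the tail value minus 1 is expanded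
  afresh.\<close>

lemma other_expansion_exists:
  assumes c: "digits c" and n: "c n < M" and ge: "1 \<le> val q (shift (Suc n) c)"
  obtains d where "digits d" "val q d = val q c" "d \<noteq> c"
proof -
  note q = base_gt_1
  have "val q (shift (Suc n) c) \<le> M / (q - 1)" using val_le q c by simp
  then obtain e where e: "digits e" "val q e = val q (shift (Suc n) c) - 1"
    using ge by (elim expansion_exists[rotated -1]) auto
  define b where "b = (\<lambda>i. if i = n then c i + 1 else c i)"
  define d where "d = splice (Suc n) b e"
  have "digits d"
    unfolding d_def using c n e(1) by (intro digits_splice) (auto simp: b_def digits_def)
  moreover have "agree n c d" by (simp add: agree_def d_def b_def splice_def)
  then have "val q d - val q c = 0"
    using val_diff[OF q c \<open>digits d\<close>] e(2) by (simp add: d_def shift_splice) (simp add: splice_def b_def)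
  moreover have "d n \<noteq> c n" by (simp add: d_def splice_def b_def)
  ultimately show ?thesis using that by (metis eq_iff_diff_eq_0)
qed

text \<open>A violated clause lets a digit be changed, after reflection if it is to be lowered.
  Conversely, the criterion for the lexicographically smaller of two expansions forces unequal
  values; if \<open>c\<close> is the larger one, both are reflected.\<close>

lemma unique_expansion_iff:
  assumes c: "digits c"
  shows "(\<forall>d. digits d \<and> val q d = val q c \<longrightarrow> d = c) \<longleftrightarrow> univoque q c"
proof
  note q = base_gt_1
  assume uniq: "\<forall>d. digits d \<and> val q d = val q c \<longrightarrow> d = c"
  have "val q (shift (Suc n) c) < 1" if n: "c n < M" for n
  proof (rule ccontr)
    assume "\<not> ?thesis"
    then have "1 \<le> val q (shift (Suc n) c)" by simp
    from other_expansion_exists[OF c n this] uniq show False by metis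
  qed
  moreover have "val q (reflect (shift (Suc n) c)) < 1" if n: "0 < c n" for n
  proof (rule ccontr)
    assume "\<not> ?thesis"
    then have "1 \<le> val q (shift (Suc n) (reflect c))" by (simp add: shift_reflect)
    moreover have "digits (reflect c)" "reflect c n < M" using c n by (simp, simp add: reflect_def)
    ultimately obtain d where d: "digits d" "val q d = val q (reflect c)" "d \<noteq> reflect c"
      using other_expansion_exists by metis
    then have "val q (reflect d) = val q c" using val_reflect[OF q] c by simp
    then have "reflect d = c" using uniq d(1) by simp
    with d(3) show False by (simp add: reflect_eq_iff)
  qed
  ultimately show "univoque q c" using c by (simp add: univoque_def)
next
  note q = base_gt_1
  have aux: False if a: "univoque q a" and b: "digits b" "val q b = val q a" and ab: "lex_less a b" for a b
  proof -
    obtain n where n: "lex_at n a b" using ab by (auto simp: lex_less_def)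
    then have "a n < M" using digitsD(2)[OF b(1), of n] by (simp add: lex_at_def)
    then have "val q a < val q b"
      using a b n by (intro val_less_if_lex_at[OF q _ _ n]) (auto simp: univoque_def)
    then show False using b by simp
  qed
  have un_reflect: "univoque q (reflect a)" if "univoque q a" for a
    using that by (simp add: univoque_def shift_reflect) (simp add: reflect_def)
  assume u: "univoque q c"
  show "\<forall>d. digits d \<and> val q d = val q c \<longrightarrow> d = c"
  proof (intro allI impI, elim conjE)
    fix d assume d: "digits d" "val q d = val q c"
    show "d = c"
    proof (rule ccontr)
      assume "d \<noteq> c"
      then consider "lex_less c d" | "lex_less (reflect c) (reflect d)" using lex_total by fastforce
      then show False
        using aux[OF u d] aux[OF un_reflect[OF u], of "reflect d"] d c q by cases (auto simp: val_reflect)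
    qed
  qed
qed

lemma univoque_seqs_eq: "univoque_seqs q = {c. univoque q c}"
proof -
  have "c \<in> univoque_seqs q \<longleftrightarrow> digits c \<and> (\<forall>d. digits d \<and> val q d = val q c \<longrightarrow> d = c)" for c
    using val_nonneg[OF base_gt_1] val_le[OF base_gt_1]
    by (auto simp: univoque_seqs_def univoque_set_def J_def is_expansion_iff ceiling_base) metis
  then show ?thesis using unique_expansion_iff by (auto simp: univoque_def)
qed

lemma univoque_number_iff: "q \<in> univoque_numbers \<longleftrightarrow> (\<exists>c. univoque q c \<and> val q c = 1)"
proof -
  have "(\<exists>!c. digits c \<and> val q c = 1) \<longleftrightarrow> (\<exists>c. univoque q c \<and> val q c = 1)"
    using unique_expansion_iff unfolding univoque_def by (metis (no_types, lifting))
  moreover have "is_expansion q 1 = (\<lambda>c. digits c \<and> val q c = 1)"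
    by (simp add: fun_eq_iff is_expansion_iff)
  ultimately show ?thesis using base_gt_1 by (simp add: univoque_numbers_def)
qed

end

lemma uniform_bound:
  fixes P :: "nat \<Rightarrow> nat \<Rightarrow> bool"
  assumes "\<And>j. j < n \<Longrightarrow> \<exists>t. P j t"
  shows "\<exists>T. \<forall>j<n. \<exists>t<T. P j t"
proof -
  from assms obtain f where f: "\<And>j. j < n \<Longrightarrow> P j (f j)" by metis
  have "f j < Suc (\<Sum>j<n. f j)" if "j < n" for j
    using that member_le_sum[of j "{..<n}" f] by (simp add: less_Suc_eq_le)
  with f show ?thesis by blast
qed

section \<open>Admissible sequences\<close>

text \<open>With \<open>h\<close> the identity or \<open>x \<mapsto> M - x\<close>, this produces arbitrarily long prefixes \<open>\<beta>\<^sub>1 \<dots> \<beta>\<^sub>m\<close> none of whose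
  proper suffixes is a prefix of \<open>\<beta>\<close> or of its reflection. The shortest offending start \<open>j\<close> of a
  suffix of \<open>\<beta>\<^sub>1 \<dots> \<beta>\<^sub>m\<close> is itself such a length, so if these were bounded, a tail of \<open>\<beta>\<close> would
  coincide with \<open>\<beta>\<close> or its reflection.\<close>

lemma cuts_exist:
  fixes h :: "int \<Rightarrow> int"
  assumes le: "\<And>n. lex_le (shift n \<beta>) \<beta>"
    and hle: "\<And>n. lex_le (h \<circ> shift n \<beta>) \<beta>"
    and neq: "\<And>n. 0 < n \<Longrightarrow> h \<circ> shift n \<beta> \<noteq> \<beta>"
  obtains m where "B \<le> m" "\<And>j. 0 < j \<Longrightarrow> j < m \<Longrightarrow> \<exists>t<m - j. lex_at t (h \<circ> shift j \<beta>) \<beta>"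
proof -
  \<comment> \<open>\<open>bad m j\<close> says that the digits of \<open>\<beta>\<close> from
    \<open>j\<close> up to \<open>m\<close>, mapped by \<open>h\<close>, form a prefix of
    \<open>\<beta>\<close>.\<close>
  define bad where "bad m j \<longleftrightarrow> 0 < j \<and> j < m \<and> agree (m - j) (h \<circ> shift j \<beta>) \<beta>" for m j
  have not_agree: "\<exists>t<l. lex_at t (h \<circ> shift j \<beta>) \<beta>" if "\<not> agree l (h \<circ> shift j \<beta>) \<beta>" for l j
  proof -
    have "h \<circ> shift j \<beta> \<noteq> \<beta>" using that unfolding agree_def by metis
    then obtain t where t: "lex_at t (h \<circ> shift j \<beta>) \<beta>"
      using hle[of j] by (auto simp: lex_le_def lex_less_def)
    have "t < l" using t that agree_mono not_less unfolding lex_at_def by blast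
    with t show ?thesis by blast
  qed
  \<comment> \<open>If the mapped tail at \<open>i\<close> fell below \<open>\<beta>\<close> before
    position \<open>m\<close>, its overlap with the bad start \<open>j\<close> would make the tail
    of \<open>\<beta>\<close> at \<open>j - i\<close> larger than \<open>\<beta>\<close>.\<close>
  have merge: "bad m i" if ji: "bad j i" and mj: "bad m j" for i j m
  proof (rule ccontr)
    assume "\<not> bad m i"
    then have "\<not> agree (m - i) (h \<circ> shift i \<beta>) \<beta>" using ji mj by (auto simp: bad_def)
    then obtain k where k: "k < m - i" "lex_at k (h \<circ> shift i \<beta>) \<beta>" using not_agree by blast
    have "j - i \<le> k"
      using k(2) ji unfolding bad_def lex_at_def agree_def by (metis less_irrefl not_le)
    then obtain t where t: "k = j - i + t" using le_Suc_ex by blast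
    have ij: "i < j" using ji by (simp add: bad_def)
    have eq: "h (\<beta> (j + u)) = \<beta> u" if "u < m - j" for u
      using mj that by (simp add: bad_def agree_def shift_def)
    have tm: "t < m - j" using t k ij by simp
    have "h (\<beta> (j + t)) < \<beta> (j - i + t)" using k t ij by (simp add: lex_at_def shift_def)
    then have "\<beta> t < shift (j - i) \<beta> t" using eq[OF tm] by (simp add: shift_def)
    moreover have "\<beta> u = shift (j - i) \<beta> u" if "u < t" for u
    proof -
      have "h (\<beta> (i + (j - i + u))) = \<beta> (j - i + u)"
        using k t that by (simp add: lex_at_def agree_def shift_def)
      then show ?thesis using eq[of u] that tm ij by (simp add: shift_def)
    qed
    ultimately have "lex_less \<beta> (shift (j - i) \<beta>)"
      by (intro lex_lessI[of t]) (simp add: lex_at_def agree_def)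
    then show False using le[of "j - i"] lex_not_le by blast
  qed
  have "\<exists>m\<ge>B. \<forall>j. \<not> bad m j"
  proof (rule ccontr)
    assume "\<not> ?thesis"
    then have all_bad: "\<exists>j. bad m j" if "B \<le> m" for m using that by blast
    have "\<exists>t. 0 < j \<longrightarrow> (h \<circ> shift j \<beta>) t \<noteq> \<beta> t" if "j < B" for j
      using neq[of j] by (auto simp: fun_eq_iff)
    then have "\<exists>T. \<forall>j<B. \<exists>t<T. 0 < j \<longrightarrow> (h \<circ> shift j \<beta>) t \<noteq> \<beta> t"
      by (rule uniform_bound)
    then obtain T where T: "\<And>j. j < B \<Longrightarrow> \<exists>t<T. 0 < j \<longrightarrow> (h \<circ> shift j \<beta>) t \<noteq> \<beta> t"
      by blast
    \<comment> \<open>By \<open>merge\<close> the least bad start is itself a length without bad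
      starts, hence below \<open>B\<close>; but \<open>T\<close> digits expose a mismatch for every
      positive start below \<open>B\<close>.\<close>
    define j where "j = (LEAST j. bad (B + T) j)"
    have j: "bad (B + T) j" unfolding j_def using all_bad[of "B + T"] by (auto intro: LeastI_ex)
    have "\<not> bad j i" for i
    proof
      assume i: "bad j i"
      then have "bad (B + T) i" using merge j by blast
      then have "j \<le> i" unfolding j_def by (rule Least_le)
      then show False using i by (simp add: bad_def)
    qed
    then have "j < B" using all_bad not_less by blast
    then obtain t where "t < T" "(h \<circ> shift j \<beta>) t \<noteq> \<beta> t" using T j by (auto simp: bad_def)
    then show False using j \<open>j < B\<close> by (auto simp: bad_def agree_def)
  qed
  then obtain m where "B \<le> m" "\<And>j. \<not> bad m j" by blast
  then show ?thesis using not_agree by (intro that[of m]) (auto simp: bad_def)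
qed

context alphabet
begin

text \<open>Tails are compared weakly so that periodic sequences, which can arise as suprema of
  tails, are included; \<open>strictly_admissible\<close> excludes them.\<close>

definition admissible :: "(nat \<Rightarrow> int) \<Rightarrow> bool" where
  "admissible \<beta> \<longleftrightarrow> digits \<beta> \<and>
     (\<forall>n. lex_le (shift n \<beta>) \<beta> \<and> lex_less (reflect (shift n \<beta>)) \<beta>)"

definition strictly_admissible :: "(nat \<Rightarrow> int) \<Rightarrow> bool" where
  "strictly_admissible \<beta> \<longleftrightarrow> admissible \<beta> \<and> (\<forall>n>0. lex_less (shift n \<beta>) \<beta>)"

lemma admissibleD:
  assumes "admissible \<beta>"
  shows "digits \<beta>" "lex_le (shift n \<beta>) \<beta>" "lex_less (reflect (shift n \<beta>)) \<beta>"
    "lex_le (reflect (shift n \<beta>)) \<beta>" "reflect (shift n \<beta>) \<noteq> \<beta>"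
  using assms lex_less_irrefl[of \<beta>] unfolding admissible_def lex_le_def by metis+

lemma reflect_cuts_exist:
  assumes "admissible \<beta>"
  obtains m where "B \<le> m"
    "\<And>j. 0 < j \<Longrightarrow> j < m \<Longrightarrow> \<exists>t<m - j. lex_at t (reflect (shift j \<beta>)) \<beta>"
proof -
  have eq: "(\<lambda>x. M - x) \<circ> shift n \<beta> = reflect (shift n \<beta>)" for n
    by (simp add: reflect_def comp_def)
  show ?thesis
    by (rule cuts_exist[of \<beta> "\<lambda>x. M - x" B], unfold eq)
      (use admissibleD[OF assms] in \<open>auto intro: that\<close>)
qed

lemma cuts_exist_strict:
  assumes "strictly_admissible \<beta>"
  obtains m where "B \<le> m" "\<And>j. 0 < j \<Longrightarrow> j < m \<Longrightarrow> \<exists>t<m - j. lex_at t (shift j \<beta>) \<beta>"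
proof -
  have *: "admissible \<beta>" "\<And>n. 0 < n \<Longrightarrow> lex_less (shift n \<beta>) \<beta>"
    using assms by (auto simp: strictly_admissible_def)
  have eq: "id \<circ> shift n \<beta> = shift n \<beta>" for n by simp
  show ?thesis
    by (rule cuts_exist[of \<beta> id B], unfold eq)
      (use *(2) admissibleD[OF *(1)] that in \<open>auto dest: *(2)\<close>)
qed

text \<open>A zero tail would reflect to the constant \<open>M\<close>, forcing
  \<open>\<beta>\<close> to be that constant. Nonzero tails make the value comparisons
  strict.\<close>

lemma tails_nonzero:
  assumes \<beta>: "digits \<beta>" and le: "\<And>n. lex_le (reflect (shift n \<beta>)) \<beta>"
  shows "shift n \<beta> \<noteq> (\<lambda>_. 0)"
proof
  assume z: "shift n \<beta> = (\<lambda>_. 0)"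
  then have "reflect (shift n \<beta>) = (\<lambda>_. M)" by (simp add: reflect_def)
  then have "\<beta> = (\<lambda>_. M)" using le[of n] lex_le_const[OF \<beta>] lex_antisym by metis
  then show False using z M_pos by (auto simp: shift_def fun_eq_iff)
qed

section \<open>Univoque numbers from strictly admissible sequences\<close>

lemma univoque_if_strictly_admissible:
  assumes "1 < p" "strictly_admissible \<beta>" "val p \<beta> = 1"
  shows "univoque p \<beta>"
proof -
  have adm: "admissible \<beta>" and less: "\<And>n. 0 < n \<Longrightarrow> lex_less (shift n \<beta>) \<beta>"
    using assms(2) by (auto simp: strictly_admissible_def)
  note ad = admissibleD[OF adm]
  have nz: "shift n \<beta> \<noteq> (\<lambda>_. 0)" for n
    using ad by (intro tails_nonzero) auto
  have "val p (shift (Suc n) \<beta>) < val p \<beta>" for n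
    using assms(1,3) ad nz less[of "Suc n"] by (intro val_le_if_tails_lex_le(2)) auto
  moreover have "val p (reflect (shift (Suc n) \<beta>)) < val p \<beta>" for n
    using assms(1,3) ad nz
    by (intro val_le_if_tails_lex_le(2)) (auto simp: shift_reflect)
  ultimately show ?thesis using ad(1) assms(3) by (simp add: univoque_def)
qed

text \<open>The intermediate value theorem in the base finds \<open>p\<close> with
  \<open>val p \<beta> = 1\<close>; the strict inequality at \<open>q\<close> gives
  \<open>p \<noteq> q\<close>.\<close>

lemma univoque_number_between:
  fixes q r :: real
  assumes "M < q" "q < r" "r \<le> M + 1" and \<beta>: "strictly_admissible \<beta>"
    and "1 < val q \<beta>" "val r \<beta> \<le> 1"
  shows "{q<..r} \<inter> univoque_numbers \<noteq> {}"
proof -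
  have q: "1 < q" using assms(1) M_pos by linarith
  have "digits \<beta>" using \<beta> by (simp add: strictly_admissible_def admissible_def)
  then obtain p where p: "q \<le> p" "p \<le> r" "val p \<beta> = 1"
    using IVT2'[of "\<lambda>x. val x \<beta>" r 1 q] continuous_on_val[OF q, of \<beta> r] assms by auto
  then have "q < p" using assms(5) by (cases "q = p") auto
  interpret p: alphabet_base M p
    by unfold_locales (use p assms in auto)
  have "univoque p \<beta>"
    using univoque_if_strictly_admissible[OF _ \<beta>] p q by simp
  then have "p \<in> univoque_numbers"
    using p.univoque_number_iff p(3) by blast
  then show ?thesis using \<open>q < p\<close> p by auto
qed

text \<open>Here \<open>\<beta>\<close> belongs to the excluded endpoint \<open>q\<close>. It is
  approximated by larger strictly admissible sequences, with values above 1 in base \<open>q\<close>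
  and eventually below 1 in base \<open>r\<close>.\<close>

lemma univoque_number_above:
  fixes q r :: real
  assumes "M < q" "q < r" "r \<le> M + 1" and \<beta>: "strictly_admissible \<beta>" and v: "val q \<beta> = 1"
  shows "{q<..r} \<inter> univoque_numbers \<noteq> {}"
proof -
  have q: "1 < q" using assms(1) M_pos by linarith
  have adm: "admissible \<beta>" and less: "\<And>n. 0 < n \<Longrightarrow> lex_less (shift n \<beta>) \<beta>"
    using \<beta> by (auto simp: strictly_admissible_def)
  note ad = admissibleD[OF adm]
  have nz: "shift n \<beta> \<noteq> (\<lambda>_. 0)" for n
    using ad by (intro tails_nonzero) auto
  have "\<exists>m. N \<le> m \<and> 0 < m \<and> (\<forall>j. 0 < j \<and> j < m \<longrightarrow> (\<exists>t<m - j. lex_at t (shift j \<beta>) \<beta>))" for N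
    by (rule cuts_exist_strict[OF \<beta>, of "Suc N"]) (metis Suc_le_eq gr_implies_not0 less_imp_le not_gr_zero)
  then obtain m where m: "\<And>N. N \<le> m N" "\<And>N. 0 < m N"
    "\<And>N j. 0 < j \<Longrightarrow> j < m N \<Longrightarrow> \<exists>t<m N - j. lex_at t (shift j \<beta>) \<beta>"
    by metis
  \<comment> \<open>Restarting \<open>\<beta>\<close> after the cut increases the sequence, since
    \<open>\<beta>\<close> exceeds its own tail; tails starting strictly inside the prefix fall
    below \<open>\<beta>\<close> before the cut.\<close>
  define a where "a N = splice (m N) \<beta> \<beta>" for N
  have dig: "digits (a N)" for N unfolding a_def using ad by (intro digits_splice)
  have agr: "agree (m N) (a N) \<beta>" for N unfolding a_def by (rule agree_splice)
  have above: "lex_less \<beta> (a N)" for N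
    using lex_less_shift_iff[OF agree_sym[OF agr[of N]]] less[OF m(2)[of N]]
    by (simp add: a_def shift_splice)
  have strict: "strictly_admissible (a N)" for N
  proof -
    have 1: "lex_less (shift j (a N)) (a N)" if "0 < j" for j
    proof (cases "j < m N")
      case True
      then obtain t where t: "t < m N - j" "lex_at t (shift j \<beta>) \<beta>" using m(3) \<open>0 < j\<close> by blast
      have "agree (Suc t) (shift j \<beta>) (shift j (a N))"
        using agree_shift[OF agree_sym[OF agr[of N]]] t(1) by simp
      moreover have "agree (Suc t) \<beta> (a N)"
        using agree_mono[OF agree_sym[OF agr[of N]]] t(1) by simp
      ultimately show ?thesis using lex_at_agree[OF t(2)] lex_lessI by blast
    next
      case False
      then show ?thesis
        using lex_le_less_trans[OF ad(2) above] by (simp add: a_def shift_splice_ge)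
    qed
    have 2: "lex_less (reflect (shift j (a N))) (a N)" for j
    proof (cases "j < m N")
      case True
      have "agree j \<beta> (a N)" using agree_mono[OF agree_sym[OF agr[of N]]] True by simp
      then have "lex_less (shift j \<beta>) (shift j (a N))" using above lex_less_shift_iff by blast
      then have "lex_less (reflect (shift j (a N))) (reflect (shift j \<beta>))" by simp
      then show ?thesis using ad(3) above lex_less_trans by blast
    next
      case False
      then show ?thesis
        using lex_less_trans[OF ad(3) above] by (simp add: a_def shift_splice_ge)
    qed
    have "lex_le (shift j (a N)) (a N)" for j
      using 1[of j] by (cases "j = 0") (auto simp: lex_le_def)
    with 1 2 dig show ?thesis by (simp add: strictly_admissible_def admissible_def)
  qed
  have "1 < val q (a N)" for N
  proof -
    obtain t where t: "lex_at t \<beta> (a N)" using above lex_less_def by blast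
    have "val q (shift (Suc t) \<beta>) < val q \<beta>"
      using q v ad nz less[of "Suc t"] by (intro val_le_if_tails_lex_le(2)) auto
    then show ?thesis using val_less_if_lex_at[OF q ad(1) dig t] v by simp
  qed
  moreover have "\<exists>N. val r (a N) < 1"
  proof -
    have "(\<lambda>N. val r (a N)) \<longlonglongrightarrow> val r \<beta>"
    proof (rule val_tendsto)
      fix i
      show "\<forall>\<^sub>F k in sequentially. a k i = \<beta> i"
        using eventually_gt_at_top[of i]
      proof eventually_elim
        case (elim k)
        then show ?case using agr[of k] m(1)[of k] by (simp add: agree_def)
      qed
    qed (use assms q ad dig in auto)
    moreover have "val r \<beta> < 1"
      using val_antimono_strict[OF q assms(2) ad(1)] nz[of 0] v by simp
    ultimately have "\<forall>\<^sub>F N in sequentially. val r (a N) < 1" by (rule order_tendstoD)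
    then show ?thesis by (auto simp: eventually_sequentially)
  qed
  ultimately show ?thesis
    using univoque_number_between[OF assms(1-3) strict] less_imp_le by blast
qed

lemma lex_at_reflect_swap: "lex_at t (reflect c) d \<longleftrightarrow> lex_at t (reflect d) c"
  by (auto simp: lex_at_def agree_def reflect_def)

lemma val_gt_near:
  assumes "1 < q" "digits c" "b < val q c"
  obtains N where "\<And>d. digits d \<Longrightarrow> agree N d c \<Longrightarrow> b < val q d"
proof -
  have "(\<lambda>n. \<Sum>i<n. real_of_int (c i) / q ^ (i + 1)) \<longlonglongrightarrow> val q c"
    using val_sums[OF assms(1,2)] by (simp only: sums_def)
  then have "\<forall>\<^sub>F n in sequentially. b < (\<Sum>i<n. real_of_int (c i) / q ^ (i + 1))"
    using assms(3) by (rule order_tendstoD)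
  then obtain N where N: "b < (\<Sum>i<N. real_of_int (c i) / q ^ (i + 1))"
    by (auto simp: eventually_sequentially)
  have "b < val q d" if d: "digits d" "agree N d c" for d
  proof -
    have "(\<Sum>i<N. real_of_int (c i) / q ^ (i + 1)) = (\<Sum>i<N. real_of_int (d i) / q ^ (i + 1))"
      using d(2) by (intro sum.cong) (auto simp: agree_def)
    then show ?thesis using N prefix_le_val[OF assms(1) d(1), of N] by simp
  qed
  then show ?thesis by (rule that)
qed

text \<open>Dropping one digit from the initial run of \<open>M\<close> only moves the first smaller
  digit, if any, forward.\<close>

lemma lex_le_tail_if_max:
  assumes "digits c" "c 0 = M"
  shows "lex_le (shift 1 c) c"
proof (rule ccontr)
  assume "\<not> ?thesis"
  then obtain t where t: "lex_at t c (shift 1 c)" by (auto simp: lex_not_le lex_less_def)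
  have "c i = M" if "i \<le> t" for i
    using that
  proof (induction i)
    case (Suc i)
    then show ?case using t by (simp add: lex_at_def agree_def shift_def)
  qed (simp add: assms)
  then have "M < c (Suc t)" using t by (simp add: lex_at_def shift_def)
  then show False using digitsD(2)[OF assms(1), of "Suc t"] by simp
qed

text \<open>The criterion's first clause is silent about a tail after the digit \<open>M\<close>;
  but that tail is at most the one before it, so a downward closed property passes on.\<close>

lemma tails_induct:
  assumes "digits x" "R x" and down: "\<And>a b. lex_le a b \<Longrightarrow> R b \<Longrightarrow> R a"
    and step: "\<And>n. x n < M \<Longrightarrow> R (shift (Suc n) x)"
  shows "R (shift n x)"
proof (induction n)
  case (Suc n)
  show ?case
  proof (cases "x n < M")
    case False
    then have "shift n x 0 = M" using digitsD(2)[OF assms(1), of n] by (simp add: shift_def)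
    then have "lex_le (shift 1 (shift n x)) (shift n x)"
      using assms(1) by (intro lex_le_tail_if_max) auto
    then show ?thesis using Suc down by simp
  qed (rule step)
qed (simp add: assms)

text \<open>The univoque expansions near a periodic \<open>\<beta>\<close> are \<open>\<beta>\<^sub>1 \<dots> \<beta>\<^sub>m\<close> followed by the reflection of the
  periodic sequence \<open>f\<close> whose period is \<open>\<beta>\<^sub>1 \<dots> \<beta>\<^sub>w\<close> followed by its reflection, where \<open>w < m\<close>.\<close>

lemma univoque_number_below_periodic:
  fixes q p :: real
  assumes "M < q" "q < p" "p \<le> M + 1" and \<beta>: "admissible \<beta>"
    and k: "0 < k" "shift k \<beta> = \<beta>" and vq: "1 < val q \<beta>" and vp: "val p \<beta> \<le> 1"
  shows "{q<..p} \<inter> univoque_numbers \<noteq> {}"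
proof -
  have q: "1 < q" using assms(1) M_pos by linarith
  note ad = admissibleD[OF \<beta>]
  \<comment> \<open>A periodic \<open>\<beta>\<close> has finitely many tails, so one
    \<open>K\<close> bounds all these positions.\<close>
  obtain K where K: "\<And>n. \<exists>t<K. lex_at t (reflect (shift n \<beta>)) \<beta>"
  proof -
    have "\<exists>t. lex_at t (reflect (shift j \<beta>)) \<beta>" for j
      using ad(3)[of j] by (simp only: lex_less_def)
    then have "\<exists>T. \<forall>j<k. \<exists>t<T. lex_at t (reflect (shift j \<beta>)) \<beta>"
      using uniform_bound[of k "\<lambda>j t. lex_at t (reflect (shift j \<beta>)) \<beta>"] by blast
    then obtain T where T: "\<And>j. j < k \<Longrightarrow> \<exists>t<T. lex_at t (reflect (shift j \<beta>)) \<beta>" by blast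
    have mult: "shift (i * k) \<beta> = \<beta>" for i
    proof (induction i)
      case (Suc i)
      have "shift (Suc i * k) \<beta> = shift (i * k) (shift k \<beta>)" by simp
      then show ?case by (simp only: k(2) Suc)
    qed simp
    have "shift n \<beta> = shift (n mod k) \<beta>" for n
      using shift_shift[of "n mod k" "n div k * k" \<beta>] by (simp only: mult div_mult_mod_eq)
    then show ?thesis using T k(1) that[of T] by (metis mod_less_divisor)
  qed
  obtain w where w: "Suc K \<le> w"
    "\<And>j. 0 < j \<Longrightarrow> j < w \<Longrightarrow> \<exists>t<w - j. lex_at t (reflect (shift j \<beta>)) \<beta>"
    using reflect_cuts_exist[OF \<beta>, of "Suc K"] by blast
  define f where "f i = (if even (i div w) then \<beta> (i mod w) else M - \<beta> (i mod w))" for i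
  have f_dig: "digits f" using ad(1) by (auto simp: digits_def f_def)
  have f_agree: "agree w f \<beta>" by (simp add: agree_def f_def)
  have f_shift: "shift w f = reflect f"
    using w(1) by (auto simp: fun_eq_iff shift_def reflect_def f_def)
  \<comment> \<open>By reflection, the tail of \<open>\<beta>\<close> at \<open>n\<close> exceeds
    \<open>reflect \<beta>\<close> at position \<open>t\<close>; since \<open>f\<close> shares
    \<open>w > t\<close> digits with \<open>\<beta>\<close>, it also exceeds
    \<open>reflect f\<close> there.\<close>
  have below: "lex_less (reflect f) x"
    if "lex_at t (reflect (shift n \<beta>)) \<beta>" "t < w" "agree (Suc t) (shift n \<beta>) x" for t n x
  proof -
    have "lex_at t (reflect \<beta>) (shift n \<beta>)" using that(1) lex_at_reflect_swap by blast
    moreover have "agree (Suc t) (reflect \<beta>) (reflect f)"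
      using agree_mono[OF agree_sym[OF f_agree], of "Suc t"] that(2) by simp
    ultimately show ?thesis using that(3) lex_at_agree lex_lessI by blast
  qed
  have below': "lex_less (reflect f) (shift n \<beta>)" for n
    using K[of n] w(1) by (auto intro!: below simp: agree_def)
  have f_less: "lex_less f \<beta>"
    using lex_less_shift_iff[OF f_agree] below' by (simp add: f_shift)
  \<comment> \<open>Stated for any cut \<open>m\<close>, because it serves both \<open>f\<close>,
    with \<open>m = w\<close>, and the final sequence \<open>a\<close>.\<close>
  have mid: "lex_less (shift j x) x \<and> lex_less (reflect (shift j x)) x"
    if cut: "\<And>j. 0 < j \<Longrightarrow> j < m \<Longrightarrow> \<exists>t<m - j. lex_at t (reflect (shift j \<beta>)) \<beta>"
      and x: "agree m x \<beta>" "shift m x = reflect f" and j: "0 < j" "j < m" for m x j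
  proof
    have agr: "agree (Suc t) (shift i \<beta>) (shift i x)" if "i + t < m" for i t
      using agree_shift[OF agree_sym[OF x(1)], of i "Suc t"] that by simp
    obtain t where t: "t < m - j" "lex_at t (reflect (shift j \<beta>)) \<beta>" using cut j by blast
    then have "lex_at t (reflect (shift j x)) x"
      using agr[of j t] agr[of 0 t] by (intro lex_at_agree[OF t(2)]) auto
    then show "lex_less (reflect (shift j x)) x" by (rule lex_lessI)
    show "lex_less (shift j x) x"
    proof (cases "agree (m - j) (shift j \<beta>) \<beta>")
      \<comment> \<open>The tail of \<open>x\<close> at \<open>j\<close> repeats its first
        \<open>m - j\<close> digits, so what remains is to compare \<open>reflect f\<close> with the
        tail at \<open>m - j\<close>. The deciding position \<open>t\<close> is below
        \<open>j\<close>, hence inside the prefix of \<open>x\<close>, and below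
        \<open>K < w\<close>, hence inside the copy of \<open>\<beta>\<close> in
        \<open>f\<close>.\<close>
      case True
      obtain t where t: "t < m - (m - j)" "lex_at t (reflect (shift (m - j) \<beta>)) \<beta>"
        using cut[of "m - j"] j by auto
      obtain t' where t': "t' < K" "lex_at t' (reflect (shift (m - j) \<beta>)) \<beta>" using K by blast
      have "t' = t" using t(2) t'(2) by (auto simp: lex_at_def intro!: lex_at_unique[OF t(2)])
      then have "lex_less (reflect f) (shift (m - j) x)"
        using t t'(1) w(1) j by (intro below[OF t(2)] agr) auto
      moreover have "agree (m - j) (shift j x) x"
        using True x(1) j by (auto simp: agree_def shift_def)
      moreover have "shift (m - j) (shift j x) = reflect f" using x(2) j by simp
      ultimately show ?thesis using lex_less_shift_iff by metis
    next
      case False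
      then have "shift j \<beta> \<noteq> \<beta>" by (auto simp: agree_def)
      then obtain t where t: "lex_at t (shift j \<beta>) \<beta>"
        using ad(2)[of j] by (auto simp: lex_le_def lex_less_def)
      have "t < m - j" using t False agree_mono not_less unfolding lex_at_def by blast
      then have "lex_at t (shift j x) x"
        using agr[of j t] agr[of 0 t] by (intro lex_at_agree[OF t]) auto
      then show ?thesis by (rule lex_lessI)
    qed
  qed
  have zero: "lex_less (reflect x) x" if x: "agree w x \<beta>" for x
  proof -
    obtain t where t: "t < K" "lex_at t (reflect \<beta>) \<beta>" using K[of 0] by auto
    have "agree (Suc t) \<beta> x" using agree_mono[OF agree_sym[OF x]] t(1) w(1) by simp
    then show ?thesis using lex_at_agree[OF t(2)] lex_lessI agree_reflect by blast
  qed
  have f_tails: "lex_le (shift j f) f \<and> lex_le (reflect (shift j f)) f" for j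
  proof (induction j rule: less_induct)
    case (less j)
    consider "j = 0" | "0 < j" "j < w" | "w \<le> j" by linarith
    then show ?case
    proof cases
      case 1
      then show ?thesis using zero[OF f_agree] by (simp add: lex_le_def)
    next
      case 2
      then show ?thesis using mid[OF w(2) f_agree f_shift] by (simp add: lex_le_def)
    next
      case 3
      then have "shift j f = reflect (shift (j - w) f)"
        using shift_shift[of "j - w" w f] by (simp add: f_shift shift_reflect)
      then show ?thesis using less[of "j - w"] 3 w(1) by simp
    qed
  qed
  obtain N where N: "\<And>d. digits d \<Longrightarrow> agree N d \<beta> \<Longrightarrow> 1 < val q d"
    using val_gt_near[OF q ad(1) vq] by blast
  obtain T where T: "lex_at T f \<beta>" using f_less lex_less_def by blast
  \<comment> \<open>\<open>N\<close> keeps the value in base \<open>q\<close> above 1,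
    \<open>T\<close> keeps \<open>f\<close> below \<open>a\<close>, and \<open>w\<close> covers the
    comparison of \<open>a\<close> with its own reflection.\<close>
  obtain m where m: "Suc (N + T + w) \<le> m"
    "\<And>j. 0 < j \<Longrightarrow> j < m \<Longrightarrow> \<exists>t<m - j. lex_at t (reflect (shift j \<beta>)) \<beta>"
    using reflect_cuts_exist[OF \<beta>, of "Suc (N + T + w)"] by blast
  define a where "a = splice m \<beta> (reflect f)"
  have a_dig: "digits a" using ad(1) f_dig by (simp add: a_def digits_splice)
  have a_agree: "agree m a \<beta>" unfolding a_def by (rule agree_splice)
  have a_shift: "shift m a = reflect f" by (simp add: a_def shift_splice)
  have "lex_at T f a"
    using agree_mono[OF agree_sym[OF a_agree], of "Suc T"] m(1)
    by (intro lex_at_agree[OF T]) (auto simp: agree_def)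
  then have fa: "lex_less f a" by (rule lex_lessI)
  have a_tails: "lex_less (reflect (shift j a)) a \<and> (0 < j \<longrightarrow> lex_less (shift j a) a)" for j
  proof -
    consider "j = 0" | "0 < j" "j < m" | "m \<le> j" by linarith
    then show ?thesis
    proof cases
      case 1
      then show ?thesis using zero[of a] agree_mono[OF a_agree] m(1) by simp
    next
      case 2
      then show ?thesis using mid[OF m(2) a_agree a_shift] by simp
    next
      case 3
      then have "shift j a = reflect (shift (j - m) f)"
        by (simp add: a_def shift_splice_ge shift_reflect)
      then show ?thesis using f_tails[of "j - m"] lex_le_less_trans[OF _ fa] by simp
    qed
  qed
  have a_le: "lex_le (shift j a) a" for j
    using a_tails[of j] by (cases "j = 0") (auto simp: lex_le_def)
  have strict: "strictly_admissible a"
    using a_dig a_tails a_le by (simp add: strictly_admissible_def admissible_def)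
  have "lex_less a \<beta>"
    using lex_less_shift_iff[OF a_agree] below' by (simp add: a_shift)
  then have "val p a \<le> val p \<beta>"
    using a_le lex_le_less_trans q assms(2)
    by (intro val_le_if_tails_lex_le(1)[OF _ a_dig ad(1) vp]) (auto simp: lex_le_def[of _ \<beta>])
  moreover have "1 < val q a" using N[OF a_dig] agree_mono[OF a_agree] m(1) by simp
  ultimately show ?thesis
    using univoque_number_between[OF assms(1-3) strict] vp by linarith
qed

section \<open>Uncountably many univoque sequences\<close>

text \<open>Weak inequalities make this set closed under digitwise limits; strictness is recovered
  later by discarding the countably many sequences that end in \<open>\<alpha>\<close> or its
  reflection.\<close>

definition dominated :: "(nat \<Rightarrow> int) \<Rightarrow> (nat \<Rightarrow> int) \<Rightarrow> bool" where
  "dominated \<alpha> c \<longleftrightarrow> digits c \<and> (\<forall>n. lex_le (shift n c) \<alpha> \<and> lex_le (reflect (shift n c)) \<alpha>)"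

lemma dominated_reflect [simp]: "dominated \<alpha> (reflect c) \<longleftrightarrow> dominated \<alpha> c"
  by (auto simp: dominated_def shift_reflect)

lemma dominated_limit:
  assumes "\<And>n. \<exists>p. dominated \<alpha> p \<and> agree n d p"
  shows "dominated \<alpha> d"
proof -
  have "digits d"
    unfolding digits_def
  proof
    fix i
    show "0 \<le> d i \<and> d i \<le> M"
      using assms[of "Suc i"] by (auto simp: dominated_def digits_def agree_def)
  qed
  moreover have "lex_le (shift n d) \<alpha> \<and> lex_le (reflect (shift n d)) \<alpha>" for n
  proof (rule ccontr)
    assume "\<not> ?thesis"
    then obtain t where t: "lex_at t \<alpha> (shift n d) \<or> lex_at t \<alpha> (reflect (shift n d))"
      by (auto simp: lex_not_le lex_less_def)
    obtain p where p: "dominated \<alpha> p" "agree (n + Suc t) d p" using assms by blast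
    have "agree (Suc t) (shift n d) (shift n p)" using p(2) by (auto intro: agree_shift)
    then have "lex_at t \<alpha> (shift n p) \<or> lex_at t \<alpha> (reflect (shift n p))"
      using t lex_at_agree[of t \<alpha> "shift n d" \<alpha> "shift n p"]
        lex_at_agree[of t \<alpha> "reflect (shift n d)" \<alpha> "reflect (shift n p)"]
      by (auto simp: agree_def[of _ \<alpha> \<alpha>])
    then have "lex_less \<alpha> (shift n p) \<or> lex_less \<alpha> (reflect (shift n p))" using lex_lessI by blast
    then show False using p(1) unfolding dominated_def lex_not_le[symmetric] by blast
  qed
  ultimately show ?thesis by (simp add: dominated_def)
qed

text \<open>\<open>c'\<close> follows \<open>c\<close> through \<open>m\<close> digits of its tail
  \<open>\<alpha>\<close> and then switches to \<open>reflect \<alpha>\<close>. This lowers every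
  tail starting before the switch, so for these only the reflections need care.\<close>

lemma dominated_branch:
  assumes \<alpha>: "admissible \<alpha>" and c: "dominated \<alpha> c" and n: "shift n c = \<alpha>"
  obtains c' where "dominated \<alpha> c'" "c' \<noteq> c" "agree N c' c" "\<exists>l. shift l c' = reflect \<alpha>"
proof -
  note ad = admissibleD[OF \<alpha>]
  have "\<exists>t. lex_at t (reflect (shift j c)) \<alpha>" if "j < Suc n" for j
  proof -
    have "reflect (shift j c) \<noteq> \<alpha>"
    proof
      assume "reflect (shift j c) = \<alpha>"
      then have "shift (n - j) (reflect (shift j c)) = shift (n - j) \<alpha>" by simp
      then have "reflect (shift (n - j) \<alpha>) = \<alpha>" using that n by (simp add: shift_reflect reflect_eq_iff)
      then show False using ad(5) by blast
    qed
    then show ?thesis using c by (auto simp: dominated_def lex_le_def lex_less_def)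
  qed
  then have "\<exists>T. \<forall>j<Suc n. \<exists>t<T. lex_at t (reflect (shift j c)) \<alpha>" by (rule uniform_bound)
  then obtain T where T: "\<And>j. j < Suc n \<Longrightarrow> \<exists>t<T. lex_at t (reflect (shift j c)) \<alpha>" by blast
  \<comment> \<open>\<open>T\<close> settles the reflected tails starting at or before
    \<open>n\<close>, the cut those starting strictly inside the copy of
    \<open>\<alpha>\<close>.\<close>
  obtain m where m: "Suc (N + T) \<le> m"
    "\<And>j. 0 < j \<Longrightarrow> j < m \<Longrightarrow> \<exists>t<m - j. lex_at t (reflect (shift j \<alpha>)) \<alpha>"
    using reflect_cuts_exist[OF \<alpha>, of "Suc (N + T)"] by blast
  define c' where "c' = splice (n + m) c (reflect \<alpha>)"
  have agr: "agree (n + m) c' c" unfolding c'_def by (rule agree_splice)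
  have sh: "shift (n + m) c' = reflect \<alpha>" by (simp add: c'_def shift_splice)
  have "shift (n + m) c = shift m \<alpha>" using n shift_shift[of m n c] by simp
  moreover have "lex_less (reflect \<alpha>) (shift m \<alpha>)" using ad(3)[of m] lex_less_reflect by fastforce
  ultimately have less: "lex_less c' c" using lex_less_shift_iff[OF agr] sh by simp
  have "lex_le (shift j c') \<alpha> \<and> lex_le (reflect (shift j c')) \<alpha>" for j
  proof (cases "j < n + m")
    case True
    have "lex_less (shift j c') (shift j c)"
      using less lex_less_shift_iff[of j c' c] agree_mono[OF agr, of j] True by simp
    then have 1: "lex_le (shift j c') \<alpha>"
      using c lex_less_le_trans unfolding dominated_def lex_le_def[of "shift j c'"] by blast
    obtain t where t: "j + t < n + m" "lex_at t (reflect (shift j c)) \<alpha>"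
    proof (cases "j < Suc n")
      case True
      then obtain t where "t < T" "lex_at t (reflect (shift j c)) \<alpha>" using T by blast
      then show ?thesis using that[of t] True m(1) by simp
    next
      case False
      then have "0 < j - n" "j - n < m" using \<open>j < n + m\<close> by linarith+
      then obtain t where "t < m - (j - n)" "lex_at t (reflect (shift (j - n) \<alpha>)) \<alpha>"
        using m(2) by blast
      moreover have "shift (j - n) \<alpha> = shift j c" using False n by auto
      ultimately show ?thesis using that[of t] False by simp
    qed
    have "agree (Suc t) (shift j c) (shift j c')"
      using agree_shift[OF agree_sym[OF agr]] t(1) by simp
    then have "lex_at t (reflect (shift j c')) \<alpha>"
      by (intro lex_at_agree[OF t(2)]) (auto simp: agree_def[of _ \<alpha>])
    then show ?thesis using 1 by (auto simp: lex_le_def lex_less_def)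
  next
    case False
    then have "shift j c' = reflect (shift (j - (n + m)) \<alpha>)"
      by (simp add: c'_def shift_splice_ge shift_reflect)
    then show ?thesis using ad(2,4) by simp
  qed
  then have "dominated \<alpha> c'"
    using c ad(1) by (simp add: dominated_def c'_def digits_splice)
  moreover have "c' \<noteq> c" using less by auto
  moreover have "agree N c' c" using agree_mono[OF agr] m(1) by simp
  ultimately show ?thesis using sh by (intro that) auto
qed

lemma uncountable_dominated:
  assumes \<alpha>: "admissible \<alpha>"
  shows "uncountable {d. agree N d \<alpha> \<and> dominated \<alpha> d}"
proof -
  \<comment> \<open>\<open>P\<close> is countable, but switching between \<open>\<alpha>\<close> and
    its reflection far out shows that no point is isolated; the closure is uncountable and still
    dominated.\<close>
  define P where "P = {c. dominated \<alpha> c \<and> (\<exists>n. shift n c = \<alpha> \<or> shift n c = reflect \<alpha>)}"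
  have "\<alpha> \<in> P" using admissibleD[OF \<alpha>] by (auto simp: P_def dominated_def intro: exI[of _ 0])
  moreover have "\<exists>p'\<in>P. p' \<noteq> p \<and> agree n p' p" if p: "p \<in> P" for p n
  proof -
    obtain l where l: "shift l p = \<alpha> \<or> shift l p = reflect \<alpha>" and dp: "dominated \<alpha> p"
      using p by (auto simp: P_def)
    from l show ?thesis
    proof
      assume "shift l p = \<alpha>"
      then show ?thesis using dominated_branch[OF \<alpha> dp, of l n] unfolding P_def by blast
    next
      assume "shift l p = reflect \<alpha>"
      then have "shift l (reflect p) = \<alpha>" by (simp add: shift_reflect)
      then obtain c' where c': "dominated \<alpha> c'" "c' \<noteq> reflect p" "agree n c' (reflect p)"
          "\<exists>l. shift l c' = reflect \<alpha>"
        using dominated_branch[OF \<alpha>, of "reflect p" l n] dp by auto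
      then have "reflect c' \<in> P" unfolding P_def by (simp add: shift_reflect) (metis reflect_reflect)
      moreover have "agree n (reflect c') p" using c'(3) agree_reflect[of n c' "reflect p"] by simp
      ultimately show ?thesis using c'(2) reflect_eq_iff by blast
    qed
  qed
  ultimately have "uncountable {d. agree N d \<alpha> \<and> (\<forall>n. \<exists>p\<in>P. agree n d p)}"
    by (rule uncountable_closure_of_perfect)
  moreover have "{d. agree N d \<alpha> \<and> (\<forall>n. \<exists>p\<in>P. agree n d p)} \<subseteq> {d. agree N d \<alpha> \<and> dominated \<alpha> d}"
    using dominated_limit unfolding P_def by blast
  ultimately show ?thesis using countable_subset by blast
qed

lemma countable_same_tail: "countable {d. \<exists>n. shift n d = a}"
proof -
  have "d \<in> range (\<lambda>xs. splice (length xs) (nth xs) a)" if "shift n d = a" for d n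
  proof -
    have "d i = a (i - n)" if "n \<le> i" for i
      using fun_cong[OF \<open>shift n d = a\<close>, of "i - n"] that by (simp add: shift_def)
    then have "d = splice (length (map d [0..<n])) (nth (map d [0..<n])) a"
      by (auto simp: fun_eq_iff splice_def)
    then show ?thesis by blast
  qed
  then have "{d. \<exists>n. shift n d = a} \<subseteq> range (\<lambda>xs. splice (length xs) (nth xs) a)" by blast
  then show ?thesis by (rule countable_subset) simp
qed

text \<open>The leading 0 is below \<open>M\<close>, so the criterion tests \<open>d\<close> itself
  and not only its later tails; in a smaller base this test can fail.\<close>

lemma univoque_Cons_0:
  assumes s: "1 < s" and \<alpha>: "admissible \<alpha>" "val s \<alpha> = 1" and d: "dominated \<alpha> d"
    and ne: "\<And>n. shift n d \<noteq> \<alpha>" "\<And>n. shift n d \<noteq> reflect \<alpha>"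
  shows "univoque s (case_nat 0 d)"
proof -
  note ad = admissibleD[OF \<alpha>(1)]
  have nz: "shift n \<alpha> \<noteq> (\<lambda>_. 0)" for n using ad by (intro tails_nonzero) auto
  have "val s (shift n d) < val s \<alpha>" for n
    using d \<alpha>(2) ad ne(1)[of n] nz s
    by (intro val_le_if_tails_lex_le(2)) (auto simp: dominated_def)
  moreover have "val s (reflect (shift n d)) < val s \<alpha>" for n
    using d \<alpha>(2) ad ne(2)[of n] nz s
    by (intro val_le_if_tails_lex_le(2)) (auto simp: dominated_def shift_reflect reflect_eq_iff)
  moreover have "shift (Suc n) (case_nat 0 d) = shift n d" for n by (simp add: shift_def)
  moreover have "digits (case_nat 0 d)"
    using d M_pos by (auto simp: dominated_def digits_def split: nat.split)
  ultimately show ?thesis using \<alpha>(2) by (simp add: univoque_def)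
qed

end

text \<open>A sequence of value below 1 lies below \<open>\<alpha>\<close> (\<open>small\<close>):
  were it larger, the criterion for \<open>\<alpha>\<close> would give it a value above 1.\<close>

lemma (in alphabet_base) admissible_if_univoque:
  assumes \<alpha>: "univoque q \<alpha>" "val q \<alpha> = 1"
  shows "admissible \<alpha>"
proof -
  note q = base_gt_1
  have dig: "digits \<alpha>" using \<alpha>(1) by (simp add: univoque_def)
  have small: "lex_less x \<alpha>" if x: "digits x" "val q x < 1" for x
  proof (rule ccontr)
    assume "\<not> ?thesis"
    moreover have "x \<noteq> \<alpha>" using x \<alpha>(2) by auto
    ultimately obtain t where t: "lex_at t \<alpha> x" using lex_total lex_less_def by blast
    then have "\<alpha> t < M" using digitsD(2)[OF x(1), of t] by (simp add: lex_at_def)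
    then have "val q \<alpha> < val q x"
      using \<alpha>(1) by (intro val_less_if_lex_at[OF q dig x(1) t]) (simp add: univoque_def)
    then show False using x \<alpha>(2) by simp
  qed
  \<comment> \<open>A smaller first digit followed by a tail of value below 1 would give a value
    below \<open>M / q < 1\<close>.\<close>
  have zero: "\<alpha> 0 = M"
  proof (rule ccontr)
    assume "\<alpha> 0 \<noteq> M"
    then have less: "\<alpha> 0 < M" using digitsD(2)[OF dig, of 0] by simp
    then have "val q (shift 1 \<alpha>) < 1" using \<alpha>(1) by (auto simp: univoque_def)
    moreover have "real_of_int (\<alpha> 0) + 1 \<le> M" using less by linarith
    ultimately have "(\<alpha> 0 + val q (shift 1 \<alpha>)) / q < 1" using base q by simp
    then show False using val_Cons[OF q dig] \<alpha>(2) by simp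
  qed
  have "lex_le (shift n \<alpha>) \<alpha>" for n
    using dig
  proof (rule tails_induct)
    show "lex_le (shift (Suc n) \<alpha>) \<alpha>" if "\<alpha> n < M" for n
      using small[of "shift (Suc n) \<alpha>"] dig \<alpha>(1) that by (simp add: univoque_def lex_le_def)
  qed (auto intro: lex_le_trans)
  moreover have "lex_less (shift n (reflect \<alpha>)) \<alpha>" for n
  proof (rule tails_induct)
    show "digits (reflect \<alpha>)" using dig by simp
    show "lex_less (reflect \<alpha>) \<alpha>"
      using zero M_pos by (intro lex_lessI[of 0]) (simp add: lex_at_def agree_def reflect_def)
    show "lex_less (shift (Suc n) (reflect \<alpha>)) \<alpha>" if "reflect \<alpha> n < M" for n
    proof -
      have "0 < \<alpha> n" using that by (simp add: reflect_def)
      then have "val q (reflect (shift (Suc n) \<alpha>)) < 1" using \<alpha>(1) by (simp add: univoque_def)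
      then show ?thesis using small[of "shift (Suc n) (reflect \<alpha>)"] dig by (simp add: shift_reflect)
    qed
  qed (auto intro: lex_le_less_trans)
  ultimately show ?thesis using dig by (simp add: admissible_def shift_reflect)
qed

lemma (in alphabet) uncountable_univoque_diff:
  fixes q r s :: real
  assumes "M < q" "q < s" "s \<le> r" "r \<le> M + 1" "s \<in> univoque_numbers"
  shows "uncountable ({c. univoque r c} - {c. univoque q c})"
proof
  assume cnt: "countable ({c. univoque r c} - {c. univoque q c})"
  have q: "1 < q" using assms(1) M_pos by linarith
  interpret s: alphabet_base M s by unfold_locales (use assms in auto)
  obtain \<alpha> where \<alpha>: "univoque s \<alpha>" "val s \<alpha> = 1" using assms(5) s.univoque_number_iff by blast
  have adm: "admissible \<alpha>" using s.admissible_if_univoque[OF \<alpha>] .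
  note ad = admissibleD[OF adm]
  have "\<alpha> \<noteq> (\<lambda>_. 0)" using tails_nonzero[of \<alpha> 0] ad by simp
  then have "1 < val q \<alpha>" using val_antimono_strict[OF q assms(2) ad(1)] \<alpha>(2) by simp
  then obtain N where N: "\<And>d. digits d \<Longrightarrow> agree N d \<alpha> \<Longrightarrow> 1 < val q d"
    using val_gt_near[OF q ad(1)] by blast
  define E where "E = {d. \<exists>n. shift n d = \<alpha>} \<union> {d. \<exists>n. shift n d = reflect \<alpha>}"
  define Y where "Y = {d. agree N d \<alpha> \<and> dominated \<alpha> d} - E"
  have "countable E" unfolding E_def using countable_same_tail by blast
  then have "uncountable Y" unfolding Y_def using uncountable_dominated[OF adm] uncountable_minus_countable by blast
  moreover have "case_nat 0 ` Y \<subseteq> {c. univoque r c} - {c. univoque q c}"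
  proof (intro image_subsetI DiffI CollectI)
    fix d assume d: "d \<in> Y"
    then have "univoque s (case_nat 0 d)"
      using s.base_gt_1 adm \<alpha>(2) by (intro univoque_Cons_0[of s \<alpha>]) (auto simp: Y_def E_def)
    then show "univoque r (case_nat 0 d)" using univoque_mono s.base_gt_1 assms(3) by blast
    have "1 < val q d" using N d by (auto simp: Y_def dominated_def)
    moreover have "shift (Suc 0) (case_nat 0 d) = d" by (simp add: shift_def)
    ultimately have "\<not> univoque q (case_nat 0 d)"
      using M_pos unfolding univoque_def by (metis nat.case(1) less_asym int_one_le_iff_zero_less)
    then show "case_nat 0 d \<notin> {c. univoque q c}" by simp
  qed
  moreover have "inj_on (case_nat (0::int)) Y"
    by (rule inj_onI) (metis nat.case(2) ext)
  ultimately show False using cnt countable_subset countable_image_inj_on by blast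
qed

section \<open>Sequences that are not ultimately periodic\<close>

lemma ultimately_periodic_shift:
  assumes "ultimately_periodic (shift n c)"
  shows "ultimately_periodic c"
proof -
  from assms obtain m p where "p > 0" "\<And>i. c (n + (m + (i + p))) = c (n + (m + i))"
    by (auto simp: ultimately_periodic_def periodic_seq_def shift_def)
  then show ?thesis
    unfolding ultimately_periodic_def periodic_seq_def
    by (intro exI[of _ "n + m"] exI[of _ p]) (simp add: add.assoc)
qed

lemma ultimately_periodic_if_shift_eq:
  assumes "0 < k" "shift k c = c"
  shows "ultimately_periodic c"
proof -
  have "c (i + k) = c i" for i using fun_cong[OF assms(2), of i] by (simp add: shift_def add.commute)
  then show ?thesis
    unfolding ultimately_periodic_def periodic_seq_def using assms(1)
    by (intro exI[of _ 0] exI[of _ k]) simp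
qed

context alphabet
begin

lemma ultimately_periodic_reflect: "ultimately_periodic (reflect c) \<Longrightarrow> ultimately_periodic c"
  by (simp add: ultimately_periodic_def periodic_seq_def reflect_def)

lemma univoque_number_if_aperiodic:
  fixes q r :: real
  assumes "M < q" "q < r" "r \<le> M + 1"
    and cr: "univoque r c" and cq: "\<not> univoque q c" and aper: "\<not> ultimately_periodic c"
  shows "{q<..r} \<inter> univoque_numbers \<noteq> {}"
proof -
  have q: "1 < q" using assms(1) M_pos by linarith
  have r: "1 < r" using q assms(2) by linarith
  have c_dig: "digits c" using cr by (simp add: univoque_def)
  \<comment> \<open>These are the sequences that the criterion tests: all have value below 1 in base
    \<open>r\<close>, and some \<open>d0\<close> has value at least 1 in base \<open>q\<close>.
    Testing a member of \<open>D\<close> leads back into \<open>D\<close>.\<close>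
  define D where "D = {shift (Suc n) c |n. c n < M} \<union> {reflect (shift (Suc n) c) |n. 0 < c n}"
  have D_dig: "digits d" if "d \<in> D" for d using that c_dig by (auto simp: D_def)
  have D_val: "val r d < 1" if "d \<in> D" for d using that cr by (auto simp: D_def univoque_def)
  have D_aper: "\<not> ultimately_periodic d" if "d \<in> D" for d
    using that aper ultimately_periodic_shift[of _ c] ultimately_periodic_reflect
    unfolding D_def by blast
  have D_shift: "shift (Suc n) d \<in> D" if d: "d \<in> D" and n: "d n < M" for d n
  proof -
    from d consider k where "d = shift (Suc k) c" | k where "d = reflect (shift (Suc k) c)"
      by (auto simp: D_def)
    then show ?thesis
    proof cases
      case 1
      then have "c (Suc (k + n)) < M" using n by (simp add: shift_def)
      moreover have "shift (Suc n) d = shift (Suc (Suc (k + n))) c" using 1 by simp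
      ultimately show ?thesis unfolding D_def by blast
    next
      case 2
      then have "0 < c (Suc (k + n))" using n by (simp add: shift_def reflect_def)
      moreover have "shift (Suc n) d = reflect (shift (Suc (Suc (k + n))) c)"
        using 2 by (simp add: shift_reflect)
      ultimately show ?thesis unfolding D_def by blast
    qed
  qed
  have D_reflect: "reflect (shift (Suc n) d) \<in> D" if d: "d \<in> D" and n: "0 < d n" for d n
  proof -
    from d consider k where "d = shift (Suc k) c" | k where "d = reflect (shift (Suc k) c)"
      by (auto simp: D_def)
    then show ?thesis
    proof cases
      case 1
      then have "0 < c (Suc (k + n))" using n by (simp add: shift_def)
      moreover have "reflect (shift (Suc n) d) = reflect (shift (Suc (Suc (k + n))) c)" using 1 by simp
      ultimately show ?thesis unfolding D_def by blast
    next
      case 2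
      then have "c (Suc (k + n)) < M" using n by (simp add: shift_def reflect_def)
      moreover have "reflect (shift (Suc n) d) = shift (Suc (Suc (k + n))) c"
        using 2 by (simp add: shift_reflect)
      ultimately show ?thesis unfolding D_def by blast
    qed
  qed
  obtain n where "c n < M \<and> 1 \<le> val q (shift (Suc n) c) \<or>
      0 < c n \<and> 1 \<le> val q (reflect (shift (Suc n) c))"
    using cq c_dig unfolding univoque_def not_less[symmetric] by blast
  then obtain d0 where d0: "d0 \<in> D" "1 \<le> val q d0"
    unfolding D_def by blast
  have "D \<noteq> {}" using d0(1) by blast
  moreover have "0 \<le> d i \<and> d i \<le> M" if "d \<in> D" for d i using digitsD[OF D_dig[OF that]] by simp
  ultimately have "\<exists>\<beta>. (\<forall>d\<in>D. lex_le d \<beta>) \<and> (\<forall>n. \<exists>d\<in>D. agree n d \<beta>)"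
    by (rule lex_sup_exists)
  then obtain \<beta> where sup: "\<And>d. d \<in> D \<Longrightarrow> lex_le d \<beta>" and near: "\<And>n. \<exists>d\<in>D. agree n d \<beta>"
    by blast
  have \<beta>_dig: "digits \<beta>"
    unfolding digits_def
  proof
    fix i
    obtain d where d: "d \<in> D" "agree (Suc i) d \<beta>" using near by blast
    then have "d i = \<beta> i" by (simp add: agree_def)
    then show "0 \<le> \<beta> i \<and> \<beta> i \<le> M" using digitsD[OF D_dig[OF d(1)], of i] by simp
  qed
  have D_tails: "lex_le (shift n d) \<beta>" if d: "d \<in> D" for d n
    using D_dig[OF d]
  proof (rule tails_induct)
    show "lex_le (shift (Suc n) d) \<beta>" if "d n < M" for n using sup D_shift d that by blast
  qed (auto intro: lex_le_trans sup[OF d])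
  \<comment> \<open>Otherwise all digits of \<open>d0\<close> would be at most \<open>M - 1\<close>,
    and its value at most \<open>(M - 1) / (q - 1) < 1\<close>.\<close>
  have \<beta>0: "\<beta> 0 = M"
  proof (rule ccontr)
    assume "\<beta> 0 \<noteq> M"
    then have "\<beta> 0 \<le> M - 1" using digitsD(2)[OF \<beta>_dig, of 0] by simp
    moreover have "d0 n \<le> \<beta> 0" for n
    proof (rule ccontr)
      assume "\<not> ?thesis"
      then have "lex_less \<beta> (shift n d0)"
        by (intro lex_lessI[of 0]) (simp add: lex_at_def agree_def shift_def)
      then show False using D_tails[OF d0(1), of n] lex_not_le by blast
    qed
    ultimately have le: "d0 n \<le> M - 1" for n using order_trans by blast
    have "val q d0 \<le> val q (\<lambda>_. M - 1)"
      unfolding val_def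
    proof (rule suminf_le)
      fix n
      have "real_of_int (d0 n) \<le> real_of_int (M - 1)" using le by (simp only: of_int_le_iff)
      then show "real_of_int (d0 n) / q ^ (n + 1) \<le> real_of_int (M - 1) / q ^ (n + 1)"
        using q by (intro divide_right_mono) auto
      show "summable (\<lambda>i. real_of_int (d0 i) / q ^ (i + 1))"
        using summable_val q D_dig d0(1) by blast
      show "summable (\<lambda>i. real_of_int (M - 1) / q ^ (i + 1))"
        by (rule summable_val[OF q]) (use M_pos in \<open>simp add: digits_def\<close>)
    qed
    also have "\<dots> < 1" using val_const[OF q, of "M - 1"] q assms(1) by simp
    finally show False using d0(2) by simp
  qed
  \<comment> \<open>The first digit \<open>M\<close> puts \<open>reflect d\<close> below
    \<open>\<beta>\<close>, which starts the induction; members of \<open>D\<close> close to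
    \<open>\<beta>\<close> have this digit.\<close>
  have D_reflect_tails: "lex_le (reflect (shift n d)) \<beta>" if d: "d \<in> D" and "d 0 = M" for d n
  proof -
    have "lex_le (shift n (reflect d)) \<beta>"
    proof (rule tails_induct)
      show "digits (reflect d)" using D_dig[OF d] by simp
      have "lex_less (reflect d) \<beta>"
        using \<open>d 0 = M\<close> \<beta>0 M_pos by (intro lex_lessI[of 0]) (simp add: lex_at_def agree_def reflect_def)
      then show "lex_le (reflect d) \<beta>" by (simp add: lex_le_def)
      show "lex_le (shift (Suc n) (reflect d)) \<beta>" if "reflect d n < M" for n
        using sup D_reflect[OF d] that by (simp add: shift_reflect) (simp add: reflect_def)
    qed (rule lex_le_trans)
    then show ?thesis by (simp add: shift_reflect)
  qed
  have \<beta>_le: "lex_le (shift n \<beta>) \<beta> \<and> lex_le (reflect (shift n \<beta>)) \<beta>" for n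
  proof (rule ccontr)
    assume "\<not> ?thesis"
    then obtain t where t: "lex_at t \<beta> (shift n \<beta>) \<or> lex_at t \<beta> (reflect (shift n \<beta>))"
      by (auto simp: lex_not_le lex_less_def)
    obtain d where d: "d \<in> D" "agree (n + Suc t) d \<beta>" using near by blast
    have "d 0 = M" using d(2) \<beta>0 by (simp add: agree_def)
    have "agree (Suc t) (shift n \<beta>) (shift n d)"
      using agree_shift[OF agree_sym[OF d(2)]] by simp
    then have "lex_at t \<beta> (shift n d) \<or> lex_at t \<beta> (reflect (shift n d))"
      using t lex_at_agree[of t \<beta> "shift n \<beta>" \<beta> "shift n d"]
        lex_at_agree[of t \<beta> "reflect (shift n \<beta>)" \<beta> "reflect (shift n d)"]
      by (auto simp: agree_def[of _ \<beta> \<beta>])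
    then have "lex_less \<beta> (shift n d) \<or> lex_less \<beta> (reflect (shift n d))" using lex_lessI by blast
    then show False
      using D_tails[OF d(1)] D_reflect_tails[OF d(1) \<open>d 0 = M\<close>] lex_not_le by blast
  qed
  have nz: "shift n \<beta> \<noteq> (\<lambda>_. 0)" for n using \<beta>_le \<beta>_dig by (intro tails_nonzero) auto
  \<comment> \<open>A tail at \<open>k > 0\<close> equal to \<open>\<beta>\<close> would give the
    period \<open>k\<close>, and a reflected one the period \<open>k + k\<close>.\<close>
  have strict_if_aper: "strictly_admissible \<beta>" if "\<not> ultimately_periodic \<beta>"
  proof -
    have ne: "shift k \<beta> \<noteq> \<beta>" if "0 < k" for k
      using ultimately_periodic_if_shift_eq[OF that] \<open>\<not> ultimately_periodic \<beta>\<close> by blast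
    have "reflect (shift k \<beta>) \<noteq> \<beta>" for k
    proof
      assume eq: "reflect (shift k \<beta>) = \<beta>"
      then have "shift k \<beta> = reflect \<beta>" by (simp add: reflect_eq_iff)
      then have "shift k (shift k \<beta>) = \<beta>" by (simp only: shift_reflect reflect_reflect)
      moreover have "\<beta> k = 0" using fun_cong[OF eq, of 0] \<beta>0 by (simp add: reflect_def shift_def)
      then have "k \<noteq> 0" using \<beta>0 M_pos by (cases "k = 0") auto
      ultimately show False using ne[of "k + k"] by simp
    qed
    then show ?thesis
      using ne \<beta>_le \<beta>_dig unfolding strictly_admissible_def admissible_def lex_le_def by blast
  qed
  have val_r: "val r \<beta> \<le> 1"
  proof (rule ccontr)
    assume "\<not> ?thesis"
    then obtain N where "\<And>d. digits d \<Longrightarrow> agree N d \<beta> \<Longrightarrow> 1 < val r d"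
      using val_gt_near[OF r \<beta>_dig, of 1] by auto
    then show False using near[of N] D_dig D_val by fastforce
  qed
  have d0_le: "val q d0 \<le> val q \<beta>" if "val q \<beta> \<le> 1"
    using val_le_if_tails_lex_le(1)[OF q D_dig[OF d0(1)] \<beta>_dig that D_tails[OF d0(1)]] .
  \<comment> \<open>As \<open>d0\<close> has value at least 1, strict comparison with
    \<open>\<beta>\<close> is impossible. Hence \<open>\<beta>\<close> lies in \<open>D\<close> and
    is not ultimately periodic.\<close>
  have d0_eq: "d0 = \<beta>" if "val q \<beta> \<le> 1"
    using val_le_if_tails_lex_le(2)[OF q D_dig[OF d0(1)] \<beta>_dig that D_tails[OF d0(1)] _ nz] d0(2) that
    by fastforce
  show ?thesis
  proof (cases "val q \<beta> \<le> 1")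
    case True
    then have "val q \<beta> = 1" using d0_le d0(2) by simp
    moreover have "\<not> ultimately_periodic \<beta>" using d0_eq[OF True] D_aper d0(1) by blast
    ultimately show ?thesis
      using univoque_number_above[OF assms(1-3) strict_if_aper] by blast
  next
    case False
    then have vq: "1 < val q \<beta>" by simp
    show ?thesis
    proof (cases "ultimately_periodic \<beta>")
      case True
      then have "\<beta> \<notin> D" using D_aper by blast
      \<comment> \<open>A close member \<open>d\<close> of \<open>D\<close> is strictly below
        \<open>\<beta>\<close>, which lies outside \<open>D\<close>. So its reflected tail at
        \<open>n\<close> exceeds that of \<open>\<beta>\<close>; if the latter were
        \<open>\<beta>\<close>, \<open>D_reflect_tails\<close> would fail.\<close>
      have "reflect (shift n \<beta>) \<noteq> \<beta>" for n
      proof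
        assume eq: "reflect (shift n \<beta>) = \<beta>"
        obtain d where d: "d \<in> D" "agree (Suc n) d \<beta>" using near by blast
        have "d 0 = M" using d(2) \<beta>0 by (simp add: agree_def)
        then have "lex_le (reflect (shift n d)) (reflect (shift n \<beta>))"
          using D_reflect_tails[OF d(1)] eq by simp
        then have "\<not> lex_less (shift n d) (shift n \<beta>)" by (simp add: lex_not_le[symmetric])
        moreover have "agree n d \<beta>" using agree_mono[OF d(2)] by simp
        ultimately have "\<not> lex_less d \<beta>" using lex_less_shift_iff by blast
        then have "d = \<beta>" using sup[OF d(1)] by (simp add: lex_le_def)
        then show False using d(1) \<open>\<beta> \<notin> D\<close> by blast
      qed
      then have adm: "admissible \<beta>" using \<beta>_le \<beta>_dig by (simp add: admissible_def lex_le_def)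
      show ?thesis
      proof (cases "\<exists>k>0. shift k \<beta> = \<beta>")
        case True
        then show ?thesis
          using univoque_number_below_periodic[OF assms(1-3) adm _ _ vq val_r] by blast
      next
        case False
        then have "strictly_admissible \<beta>"
          using adm \<beta>_le unfolding strictly_admissible_def lex_le_def by blast
        then show ?thesis using univoque_number_between[OF assms(1-3) _ vq val_r] by blast
      qed
    next
      case False
      then show ?thesis
        using univoque_number_between[OF assms(1-3) strict_if_aper vq val_r] by blast
    qed
  qed
qed

section \<open>Limits of univoque numbers from the right\<close>

text \<open>Expansions of 1 in bases tending to \<open>r\<close> from the right cluster at some
  \<open>\<gamma>\<close> that satisfies the criterion weakly. The first clause becomes strict
  because these bases exceed \<open>r\<close>, the second by comparing reflected tails with
  \<open>\<gamma>\<close>.\<close>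

lemma univoque_number_right_limit:
  fixes r :: real
  assumes r: "M < r" "r < M + 1"
    and lim: "\<And>e. 0 < e \<Longrightarrow> \<exists>s\<in>univoque_numbers. r < s \<and> s < r + e"
  shows "r \<in> univoque_numbers"
proof -
  have r1: "1 < r" using r M_pos by linarith
  have "\<exists>s a. r < s \<and> s < r + 1 / Suc k \<and> univoque s a \<and> val s a = 1" for k
  proof -
    \<comment> \<open>The bound \<open>M + 1 - r\<close> keeps \<open>s\<close> among the bases with
      the same digits.\<close>
    obtain s where s: "s \<in> univoque_numbers" "r < s" "s < r + min (1 / Suc k) (M + 1 - r)"
      using lim[of "min (1 / Suc k) (M + 1 - r)"] r by auto
    interpret s: alphabet_base M s by unfold_locales (use r s in auto)
    show ?thesis using s s.univoque_number_iff by auto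
  qed
  then obtain s0 a0 where sa0: "\<And>k. r < s0 k" "\<And>k. s0 k < r + 1 / Suc k"
    "\<And>k. univoque (s0 k) (a0 k)" "\<And>k. val (s0 k) (a0 k) = 1"
    by metis
  then have "0 \<le> a0 k i \<and> a0 k i \<le> M" for k i by (simp add: univoque_def digits_def)
  then obtain \<gamma> where \<gamma>: "\<And>n. infinite {k. agree n (a0 k) \<gamma>}"
    using cluster_sequence_exists by blast
  then have "\<exists>k\<ge>n. agree n (a0 k) \<gamma>" for n
    using infinite_nat_iff_unbounded_le[of "{k. agree n (a0 k) \<gamma>}"] by blast
  then obtain K where K: "\<And>n. n \<le> K n" "\<And>n. agree n (a0 (K n)) \<gamma>" by metis
  define s a where "s n = s0 (K n)" and "a n = a0 (K n)" for n
  have s: "r < s n" and a: "univoque (s n) (a n)" "val (s n) (a n) = 1" "agree n (a n) \<gamma>" for n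
    using sa0 K by (auto simp: s_def a_def)
  have a_dig: "digits (a n)" for n using a(1) by (simp add: univoque_def)
  have s_lim: "s \<longlonglongrightarrow> r"
  proof (rule tendsto_sandwich[of "\<lambda>_. r" _ _ "\<lambda>n. r + 1 / Suc n"])
    have "s n \<le> r + 1 / Suc n" for n
    proof -
      have "1 / real (Suc (K n)) \<le> 1 / real (Suc n)" using K(1)[of n] by (intro frac_le) auto
      then show ?thesis using sa0(2)[of "K n"] by (simp add: s_def)
    qed
    then show "\<forall>\<^sub>F n in sequentially. s n \<le> r + 1 / Suc n" by simp
    have "(\<lambda>n. r + 1 / Suc n) \<longlonglongrightarrow> r + 0"
      by (intro tendsto_add tendsto_const LIMSEQ_Suc lim_const_over_n)
    then show "(\<lambda>n. r + 1 / Suc n) \<longlonglongrightarrow> r" by simp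
    show "\<forall>\<^sub>F n in sequentially. r \<le> s n" using s by (simp add: less_imp_le)
  qed simp
  have a_lim: "\<forall>\<^sub>F n in sequentially. a n i = \<gamma> i" for i
    using eventually_gt_at_top[of i]
  proof eventually_elim
    case (elim n)
    then show ?case using a(3)[of n] by (simp add: agree_def)
  qed
  have \<gamma>_dig: "digits \<gamma>"
    unfolding digits_def
  proof
    fix i
    have "a (Suc i) i = \<gamma> i" using a(3)[of "Suc i"] by (simp add: agree_def)
    then show "0 \<le> \<gamma> i \<and> \<gamma> i \<le> M" using digitsD[OF a_dig, of "Suc i" i] by simp
  qed
  have shift_lim: "(\<lambda>n. val (s n) (shift j (a n))) \<longlonglongrightarrow> val r (shift j \<gamma>)" for j
  proof (rule val_tendsto[OF r1 _ _ _ s_lim])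
    show "\<forall>\<^sub>F n in sequentially. shift j (a n) i = shift j \<gamma> i" for i
      using a_lim[of "j + i"] by (simp add: shift_def)
  qed (simp_all add: \<gamma>_dig a_dig)
  have reflect_lim: "(\<lambda>n. val (s n) (reflect (shift j (a n)))) \<longlonglongrightarrow> val r (reflect (shift j \<gamma>))" for j
  proof (rule val_tendsto[OF r1 _ _ _ s_lim])
    show "\<forall>\<^sub>F n in sequentially. reflect (shift j (a n)) i = reflect (shift j \<gamma>) i" for i
      using a_lim[of "j + i"] by (simp add: shift_def reflect_def)
  qed (simp_all add: \<gamma>_dig a_dig)
  have val_\<gamma>: "val r \<gamma> = 1"
    using shift_lim[of 0] a(2) LIMSEQ_unique[OF tendsto_const] by fastforce
  have greedy_le: "val r (shift (Suc j) \<gamma>) \<le> 1" if j: "\<gamma> j < M" for j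
  proof (rule tendsto_upperbound[OF shift_lim])
    show "\<forall>\<^sub>F n in sequentially. val (s n) (shift (Suc j) (a n)) \<le> 1"
      using a_lim[of j]
    proof eventually_elim
      case (elim n)
      then show ?case using a(1)[of n] j by (auto simp: univoque_def intro: less_imp_le)
    qed
  qed simp
  have lazy_le: "val r (reflect (shift (Suc j) \<gamma>)) \<le> 1" if j: "0 < \<gamma> j" for j
  proof (rule tendsto_upperbound[OF reflect_lim])
    show "\<forall>\<^sub>F n in sequentially. val (s n) (reflect (shift (Suc j) (a n))) \<le> 1"
      using a_lim[of j]
    proof eventually_elim
      case (elim n)
      then show ?case using a(1)[of n] j by (auto simp: univoque_def intro: less_imp_le)
    qed
  qed simp
  \<comment> \<open>\<open>a n\<close> shares the digits up to \<open>j\<close> with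
    \<open>\<gamma>\<close>. In the larger base \<open>s n\<close> they contribute no more, and a
    tail of value below 1 contributes less than one of value 1 in base \<open>r\<close>; so
    \<open>a n\<close> would miss the value 1.\<close>
  have greedy: "val r (shift (Suc j) \<gamma>) < 1" if j: "\<gamma> j < M" for j
  proof (rule ccontr)
    assume "\<not> ?thesis"
    then have eq: "val r (shift (Suc j) \<gamma>) = 1" using greedy_le[OF j] by simp
    define n where "n = Suc j"
    have agr: "a n i = \<gamma> i" if "i \<le> j" for i using a(3)[of n] that by (simp add: n_def agree_def)
    have tail: "val (s n) (shift (Suc j) (a n)) < 1"
      using a(1)[of n] j agr[of j] by (auto simp: univoque_def)
    have sn: "1 < s n" using s[of n] r1 by linarith
    have "(\<Sum>i<Suc j. real_of_int (a n i) / s n ^ (i + 1)) \<le> (\<Sum>i<Suc j. real_of_int (\<gamma> i) / r ^ (i + 1))"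
    proof (rule sum_mono)
      fix i assume "i \<in> {..<Suc j}"
      then have "a n i = \<gamma> i" using agr by simp
      then show "real_of_int (a n i) / s n ^ (i + 1) \<le> real_of_int (\<gamma> i) / r ^ (i + 1)"
        using digitsD(1)[OF \<gamma>_dig, of i] s[of n] r1 by (auto intro!: divide_left_mono power_mono mult_pos_pos zero_less_power simp del: power_Suc)
    qed
    moreover have "val (s n) (shift (Suc j) (a n)) / s n ^ Suc j < val r (shift (Suc j) \<gamma>) / r ^ Suc j"
    proof -
      have "val (s n) (shift (Suc j) (a n)) / s n ^ Suc j < 1 / s n ^ Suc j"
        using tail sn by (intro divide_strict_right_mono) auto
      also have "\<dots> \<le> 1 / r ^ Suc j"
        using s[of n] r1 by (intro frac_le power_mono) auto
      finally show ?thesis by (simp only: eq)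
    qed
    ultimately have "val (s n) (a n) < val r \<gamma>"
      using val_split[OF sn a_dig, of n "Suc j"] val_split[OF r1 \<gamma>_dig, of "Suc j"] by linarith
    then show False using a(2) val_\<gamma> by simp
  qed
  \<comment> \<open>After a last nonzero digit the reflected tail would be constantly
    \<open>M\<close>, of value \<open>M / (r - 1) > 1\<close> because
    \<open>r < M + 1\<close>.\<close>
  have nz: "shift j \<gamma> \<noteq> (\<lambda>_. 0)" for j
  proof
    assume "shift j \<gamma> = (\<lambda>_. 0)"
    then have ex: "\<exists>j. shift j \<gamma> = (\<lambda>_. 0)" by blast
    define l where "l = (LEAST j. shift j \<gamma> = (\<lambda>_. 0))"
    have l: "shift l \<gamma> = (\<lambda>_. 0)" unfolding l_def using ex by (rule LeastI_ex)
    have "\<gamma> \<noteq> (\<lambda>_. 0)" using val_\<gamma> val_const[OF r1, of 0] by auto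
    then obtain i where i: "l = Suc i" using l by (cases l) auto
    have "\<gamma> i \<noteq> 0"
    proof
      assume "\<gamma> i = 0"
      then have "shift i \<gamma> x = 0" for x
        using fun_cong[OF l, of "x - 1"] by (cases x) (auto simp: shift_def i)
      then have "l \<le> i" unfolding l_def by (intro Least_le) auto
      then show False using i by simp
    qed
    then have "0 < \<gamma> i" using digitsD(1)[OF \<gamma>_dig, of i] by simp
    then have "val r (reflect (shift l \<gamma>)) \<le> 1" using lazy_le i by simp
    moreover have "reflect (shift l \<gamma>) = (\<lambda>_. M)" by (simp add: l reflect_def)
    ultimately have "M / (r - 1) \<le> 1" using val_const[OF r1, of M] by simp
    then show False using r r1 by simp
  qed
  have lazy: "val r (reflect (shift (Suc k) \<gamma>)) < 1" if k: "0 < \<gamma> k" for k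
  proof (rule ccontr)
    assume ge: "\<not> ?thesis"
    define \<delta> where "\<delta> = reflect (shift (Suc k) \<gamma>)"
    have \<delta>: "digits \<delta>" "val r \<delta> = 1"
      using \<gamma>_dig lazy_le[OF k] ge by (auto simp: \<delta>_def)
    \<comment> \<open>Both have value 1. Equality gives \<open>\<gamma>\<close> the period
      \<open>2 * (k + 1)\<close>, against \<open>greedy\<close> at the last digit of the period;
      \<open>\<gamma>\<close> smaller contradicts \<open>greedy\<close>; \<open>\<delta>\<close>
      smaller contradicts \<open>lazy_le\<close> and the nonzero tails of
      \<open>\<gamma>\<close>.\<close>
    consider "\<delta> = \<gamma>" | n where "lex_at n \<gamma> \<delta>" | n where "lex_at n \<delta> \<gamma>"
      using lex_total[of \<delta> \<gamma>] lex_less_def by blast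
    then show False
    proof cases
      case 1
      then have sh: "shift (Suc k) \<gamma> = reflect \<gamma>" by (auto simp: \<delta>_def reflect_eq_iff)
      have "shift (Suc (Suc k + k)) \<gamma> = shift (Suc k) (shift (Suc k) \<gamma>)" by simp
      also have "\<dots> = \<gamma>" by (simp only: sh shift_reflect reflect_reflect)
      finally have "shift (Suc (Suc k + k)) \<gamma> = \<gamma>" .
      moreover have "\<gamma> (Suc k + k) < M"
        using fun_cong[OF sh, of k] k by (simp add: shift_def reflect_def)
      ultimately show False using greedy[of "Suc k + k"] val_\<gamma> by simp
    next
      case (2 n)
      then have "\<gamma> n < M" using digitsD(2)[OF \<delta>(1), of n] by (simp add: lex_at_def)
      then have "val r \<gamma> < val r \<delta>" using val_less_if_lex_at[OF r1 \<gamma>_dig \<delta>(1) 2] greedy by blast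
      then show False using \<delta>(2) val_\<gamma> by simp
    next
      case (3 n)
      then have "0 < \<gamma> (Suc k + n)"
        using digitsD(2)[OF \<gamma>_dig, of n] by (simp add: lex_at_def \<delta>_def reflect_def shift_def)
      then have "val r (shift (Suc n) \<delta>) \<le> 1"
        using lazy_le[of "Suc k + n"] by (simp add: \<delta>_def shift_reflect)
      then have "val r \<delta> \<le> val r \<gamma> - val r (shift (Suc n) \<gamma>) / r ^ Suc n"
        using val_le_if_lex_at[OF r1 \<delta>(1) \<gamma>_dig 3] by blast
      moreover have "0 < val r (shift (Suc n) \<gamma>) / r ^ Suc n"
        using val_pos[OF r1 digits_shift[OF \<gamma>_dig] nz] r1 by simp
      ultimately show False using \<delta>(2) val_\<gamma> by linarith
    qed
  qed
  interpret rb: alphabet_base M r by unfold_locales (use r in auto)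
  have "univoque r \<gamma>" using \<gamma>_dig greedy lazy by (simp add: univoque_def)
  then show ?thesis using rb.univoque_number_iff val_\<gamma> by blast
qed

text \<open>To the right of \<open>M + 1\<close> the alphabet changes, so the limit argument stops
  short of this base; the constant sequence \<open>M\<close> settles it.\<close>

lemma integer_univoque_number: "real_of_int (M + 1) \<in> univoque_numbers"
proof -
  interpret b: alphabet_base M "real_of_int (M + 1)" by unfold_locales auto
  note q = b.base_gt_1
  have "reflect (shift (Suc n) (\<lambda>_. M)) = (\<lambda>_. 0)" for n by (simp add: shift_def reflect_def)
  then have "univoque (real_of_int (M + 1)) (\<lambda>_. M)"
    using digits_M val_const[OF q, of 0] by (simp add: univoque_def)
  moreover have "val (real_of_int (M + 1)) (\<lambda>_. M) = 1" using val_const[OF q, of M] M_pos by simp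
  ultimately show ?thesis using b.univoque_number_iff by blast
qed

lemma univoque_number_if_closure:
  fixes q r :: real
  assumes "M < q" "r \<le> M + 1" "{q<..r} \<inter> closure univoque_numbers \<noteq> {}"
  shows "{q<..r} \<inter> univoque_numbers \<noteq> {}"
proof (rule ccontr)
  assume no: "\<not> ?thesis"
  obtain s where s: "q < s" "s \<le> r" "s \<in> closure univoque_numbers" using assms(3) by auto
  have "s \<notin> univoque_numbers" using no s by auto
  \<comment> \<open>Univoque numbers within \<open>s - q\<close> of \<open>s\<close> exceed
    \<open>q\<close>, hence also \<open>r\<close>, so they approach \<open>s\<close> only from the
    right.\<close>
  have "\<exists>t\<in>univoque_numbers. s < t \<and> t < s + e" if "0 < e" for e
  proof -
    define e' where "e' = min e (s - q)"
    have "0 < e'" using that s by (simp add: e'_def)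
    then obtain t where t: "t \<in> univoque_numbers" "dist t s < e'"
      using s(3) closure_approachable by blast
    then have "q < t" "t < s + e" by (auto simp: e'_def dist_real_def)
    moreover have "r < t" using no t(1) \<open>q < t\<close> by fastforce
    ultimately show ?thesis using t(1) s(2) by force
  qed
  moreover have "s < M + 1"
    using integer_univoque_number \<open>s \<notin> univoque_numbers\<close> s(2) assms(2)
    by (metis of_int_1 of_int_add order_trans order_le_less)
  ultimately have "s \<in> univoque_numbers"
    using univoque_number_right_limit[of s] s(1) assms(1) by simp
  then show False using \<open>s \<notin> univoque_numbers\<close> by blast
qed

end

section \<open>Equivalence of the four conditions\<close>

theorem theorem1p2:
  fixes q r :: real
  assumes "1 < q" and "q < r" and "\<lceil>q\<rceil> = \<lceil>r\<rceil>"
  shows "({q<..r} \<inter> univoque_numbers = {} \<longleftrightarrow> {q<..r} \<inter> closure univoque_numbers = {}) \<and>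
    ({q<..r} \<inter> closure univoque_numbers = {} \<longleftrightarrow>
      (\<forall>c \<in> univoque_seqs r - univoque_seqs q. ultimately_periodic c)) \<and>
    ((\<forall>c \<in> univoque_seqs r - univoque_seqs q. ultimately_periodic c) \<longleftrightarrow>
      countable (univoque_seqs r - univoque_seqs q))"
proof -
  define M where "M = \<lceil>q\<rceil> - 1"
  have q: "real_of_int M < q" "q \<le> real_of_int (M + 1)" unfolding M_def by linarith+
  have r: "real_of_int M < r" "r \<le> real_of_int (M + 1)" unfolding M_def assms(3) by linarith+
  interpret alphabet M
    by unfold_locales (use assms(1) in \<open>simp add: M_def le_ceiling_iff\<close>)
  interpret qb: alphabet_base M q by unfold_locales (use q in auto)
  interpret rb: alphabet_base M r by unfold_locales (use r in auto)
  let ?U = "{q<..r} \<inter> univoque_numbers = {}"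
  let ?V = "{q<..r} \<inter> closure univoque_numbers = {}"
  let ?S = "univoque_seqs r - univoque_seqs q"
  have "?U \<longleftrightarrow> ?V"
    using univoque_number_if_closure[OF q(1) r(2)] closure_subset[of univoque_numbers] by blast
  moreover have "\<forall>c\<in>?S. ultimately_periodic c" if "?U"
    using that univoque_number_if_aperiodic[OF q(1) assms(2) r(2)]
    by (auto simp: qb.univoque_seqs_eq rb.univoque_seqs_eq)
  moreover have "countable ?S" if "\<forall>c\<in>?S. ultimately_periodic c"
  proof (rule countable_subset[OF _ countable_ultimately_periodic])
    show "?S \<subseteq> {c. ultimately_periodic c}" using that by blast
  qed
  moreover have "?U" if "countable ?S"
    using that uncountable_univoque_diff[OF q(1) _ _ r(2)]
    by (fastforce simp: qb.univoque_seqs_eq rb.univoque_seqs_eq)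
  ultimately show ?thesis by blast
qed

end
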